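(* Let $F=\sum_{k=1}^N a_kG_k$, where $a_1,\dots,a_N$ is some sequence of real numbers, not necessarily positive. Let $B=(Q_0,Q_1,Q_2,Q_3)$ be a good block. Then $$\min_{v\in\langle B\rangle}\mathcal{E}(v)>\min_{v\in B}\mathcal{E}(v)-\mathbf{ERR}(B),$$ where $\mathcal{E}=\mathcal{E}_F$ and $\mathbf{ERR}(B)=\sum_{i=0}^{3}\sum_{j=0}^{4}\epsilon(Q_i,Q_j)$, with $\epsilon(Q_i,Q_j)=\sum_{k=1}^N|a_k|\,\epsilon_k(Q_i,Q_j)$ and $Q_4=\{\infty\}$.
   Context: Potentials: $G_k(r)=(4-r^2)^k$ for $r\in[0,2]$, $k\ge 1$ an integer. Inverse stereographic projection: for $(x,y)\in\mathbb{R}^2$, $\Sigma^{-1}(x,y)=\left(\frac{2x}{1+x^2+y^2},\frac{2y}{1+x^2+y^2},1-\frac{2}{1+x^2+y^2}\right)\in S^2$, the unit sphere in $\mathbb{R}^3$. For $z\in\mathbb{R}^2$ write $\widehat z=\Sigma^{-1}(z)$, and put $\widehat\infty=(0,0,1)$; for a set $A$, $\widehat A=\{\widehat z: z\in A\}$. $\langle A\rangle$ denotes the convex hull of $A$. Energy: for $z_0,z_1,z_2,z_3\in\mathbb{R}^2$ and $z_4=\infty$, $\mathcal{E}_F(z_0,z_1,z_2,z_3)=\sum_{0\le i<j\le4}F(\|\widehat z_i-\widehat z_j\|)$. Dyadic objects: a dyadic segment is a segment obtained from $[0,4]$ (in the $x$-axis $\mathbb{R}\times\{0\}$) by repeatedly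 cutting in half; a dyadic square is a square obtained from $[-2,2]^2$ by repeatedly cutting into four equal quarters (the initial segment and square are included). Such an object $Q$ is identified with its set of vertices ($2$ or $4$ points), and $\langle Q\rangle$ is the solid segment or square. A dyadic square is good if it is contained in $[-3/2,3/2]^2$ and has side length at most $1/2$. A good block is $B=(Q_0,Q_1,Q_2,Q_3)$ with $Q_0$ a dyadic segment and $Q_1,Q_2,Q_3$ good dyadic squares. Then $\langle B\rangle=\langle Q_0\rangle\times\langle Q_1\rangle\times\langle Q_2\rangle\times\langle Q_3\rangle$, and in "$v\in B$" we view $B$ as the finite set of vertices $Q_0\times Q_1\times Q_2\times Q_3$ ($128$ configurations). Constants of $Q$ (dyadic segment or good dyadic square): $d(Q)$ is the diameter of $\langle\widehat Q\rangle\subset\mathbb{R}^3$. $d_1(Q)$ is the length of the longest edge of $\langle\widehat Q\rangle$. $d_2(Q)$ is the diameter (in $\mathbb{R}^3$) of $\widehat{D_Q}$, where $D_Q\subset\mathbb{R}^2$ is the disk having the vertices of $Q$ on its boundary (for a segment, the disk having the segment as a diameter). Let $\chi(D,d)=\frac{d^2}{4D}+\frac{d^4}{2D^3}$. The hull approximation constant is $\delta(Q)=\chi(2,d_2(Q))$ for a dyadic segment and $\delta(Q)=\max\bigl(\chi(1,d_1(Q)),\chi(2,d_2(Q))\bigr)$ for a good dyadic square. For $Q=\{\infty\}$, $d(Q)=\delta(Q)=0$. Dot product bound: for $Q,Q'$ dyadic segments or good dyadic squares with vertices $q_i$ and $q_j'$, $(Q\cdot Q')_{\max}=\max_{i,j}(\widehat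 q_i\cdot\widehat q_j')+\delta(Q)+\delta(Q')+\delta(Q)\delta(Q')$, and $(Q\cdot\{\infty\})_{\max}=\max_i\widehat q_i\cdot(0,0,1)$. Error function: $\epsilon_k(Q,Q)=0$ for all $Q$. When $Q,Q'$ are unequal, with $T=2+2(Q\cdot Q')_{\max}$, $$\epsilon_k(Q,Q')=\tfrac12k(k-1)T^{k-2}d(Q)^2+2kT^{k-1}\delta(Q)$$ (the first term is $0$ when $k=1$).
   Formalization: Some a_k is assumed nonzero (if all vanish the claim reads 0 > 0), and ε_k(Q,Q)=0 is applied only to i=j in ERR(B), so distinct positions with coinciding squares keep the error of the general formula; with zero error there the claim fails, e.g. for G_k, k large, Q_1=Q_2=Q_3. *)

theory Defs
  imports "HOL-Analysis.Analysis"
begin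

subsection \<open>Stereographic projection and energy\<close>

definition inv_stereo :: "real^2 \<Rightarrow> real^3" where
  "inv_stereo z = (let n = 1 + (z$1)\<^sup>2 + (z$2)\<^sup>2
     in vector [2 * z$1 / n, 2 * z$2 / n, 1 - 2 / n])"

text \<open>The extended plane is \<^typ>\<open>(real^2) option\<close>, with \<^term>\<open>None\<close> as the point at infinity.\<close>

fun hat :: "(real^2) option \<Rightarrow> real^3" where
  "hat (Some z) = inv_stereo z"
| "hat None = vector [0, 0, 1]"

definition G :: "nat \<Rightarrow> real \<Rightarrow> real" where
  "G k r = (4 - r\<^sup>2) ^ k"

definition potential :: "(nat \<Rightarrow> real) \<Rightarrow> nat \<Rightarrow> real \<Rightarrow> real" where
  "potential a N r = (\<Sum>k = 1..N. a k * G k r)"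

type_synonym config = "(real^2) \<times> (real^2) \<times> (real^2) \<times> (real^2)"

definition energy :: "(real \<Rightarrow> real) \<Rightarrow> config \<Rightarrow> real" where
  "energy F = (\<lambda>(z0, z1, z2, z3).
     let z = (!) [Some z0, Some z1, Some z2, Some z3, None]
     in \<Sum>j = 0..4. \<Sum>i<j. F (norm (hat (z i) - hat (z j))))"

subsection \<open>Dyadic segments and squares, good blocks\<close>

text \<open>Segments are generated as pairs (left end point, length), squares as triples
  (coordinates of the lower left corner, side length), and then turned into vertex sets.\<close>

inductive dyadic_interval :: "real \<Rightarrow> real \<Rightarrow> bool" where
  "dyadic_interval 0 4"
| "dyadic_interval x s \<Longrightarrow> dyadic_interval x (s / 2)"
| "dyadic_interval x s \<Longrightarrow> dyadic_interval (x + s / 2) (s / 2)"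

inductive dyadic_box :: "real \<Rightarrow> real \<Rightarrow> real \<Rightarrow> bool" where
  "dyadic_box (-2) (-2) 4"
| "dyadic_box x y s \<Longrightarrow> dx \<in> {0, s / 2} \<Longrightarrow> dy \<in> {0, s / 2}
     \<Longrightarrow> dyadic_box (x + dx) (y + dy) (s / 2)"

definition segment_vertices :: "real \<Rightarrow> real \<Rightarrow> (real^2) set" where
  "segment_vertices x s = {vector [x, 0], vector [x + s, 0]}"

definition square_vertices :: "real \<Rightarrow> real \<Rightarrow> real \<Rightarrow> (real^2) set" where
  "square_vertices x y s =
     {vector [x, y], vector [x + s, y], vector [x, y + s], vector [x + s, y + s]}"

definition dyadic_segment :: "(real^2) set \<Rightarrow> bool" where
  "dyadic_segment Q \<longleftrightarrow> (\<exists>x s. dyadic_interval x s \<and> Q = segment_vertices x s)"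

definition good_square :: "(real^2) set \<Rightarrow> bool" where
  "good_square Q \<longleftrightarrow> (\<exists>x y s. dyadic_box x y s \<and> Q = square_vertices x y s \<and> s \<le> 1 / 2
     \<and> convex hull Q \<subseteq> cbox (vector [-3/2, -3/2]) (vector [3/2, 3/2]))"

type_synonym block = "(real^2) set \<times> (real^2) set \<times> (real^2) set \<times> (real^2) set"

fun good_block :: "block \<Rightarrow> bool" where
  "good_block (Q0, Q1, Q2, Q3) \<longleftrightarrow>
     dyadic_segment Q0 \<and> good_square Q1 \<and> good_square Q2 \<and> good_square Q3"

fun block_vertices :: "block \<Rightarrow> config set" where
  "block_vertices (Q0, Q1, Q2, Q3) = Q0 \<times> Q1 \<times> Q2 \<times> Q3"

fun block_solid :: "block \<Rightarrow> config set" where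
  "block_solid (Q0, Q1, Q2, Q3) =
     (convex hull Q0) \<times> (convex hull Q1) \<times> (convex hull Q2) \<times> (convex hull Q3)"

subsection \<open>The constants of a segment or square\<close>

definition hull_diam :: "(real^2) set \<Rightarrow> real" where
  "hull_diam Q = diameter (convex hull (inv_stereo ` Q))"

definition hull_edge :: "(real^2) set \<Rightarrow> real" where
  "hull_edge Q = Max (diameter ` {e. e edge_of convex hull (inv_stereo ` Q)})"

text \<open>For the two vertices of a segment, the condition that the centre lies in the hull singles
  out the disk with the segment as a diameter; for a square it is automatic.\<close>

definition vertex_disk :: "(real^2) set \<Rightarrow> (real^2) set" where
  "vertex_disk Q = (THE D. \<exists>c r. D = cball c r \<and> Q \<subseteq> sphere c r \<and> c \<in> convex hull Q)"

definition disk_diam :: "(real^2) set \<Rightarrow> real" where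
  "disk_diam Q = diameter (inv_stereo ` vertex_disk Q)"

definition chi :: "real \<Rightarrow> real \<Rightarrow> real" where
  "chi D d = d\<^sup>2 / (4 * D) + d ^ 4 / (2 * D ^ 3)"

definition hull_const :: "(real^2) set \<Rightarrow> real" where
  "hull_const Q = (if dyadic_segment Q then chi 2 (disk_diam Q)
     else max (chi 1 (hull_edge Q)) (chi 2 (disk_diam Q)))"

subsection \<open>The error term\<close>

datatype cell = Cell "(real^2) set" | Infinity

text \<open>\<^term>\<open>Infinity\<close> stands for the singleton of the point at infinity, which occurs only as
  the second cell of a pair. Its own diameter and hull constant, which are zero, never enter.\<close>

fun dot_max :: "(real^2) set \<Rightarrow> cell \<Rightarrow> real" where
  "dot_max Q (Cell Q') =
     Max {inv_stereo q \<bullet> inv_stereo q' | q q'. q \<in> Q \<and> q' \<in> Q'}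
     + hull_const Q + hull_const Q' + hull_const Q * hull_const Q'"
| "dot_max Q Infinity = Max {inv_stereo q \<bullet> hat None | q. q \<in> Q}"

text \<open>The error of a pair of different members of a block.\<close>

definition pair_error :: "nat \<Rightarrow> (real^2) set \<Rightarrow> cell \<Rightarrow> real" where
  "pair_error k Q Q' = (let T = 2 + 2 * dot_max Q Q' in
     1 / 2 * real k * (real k - 1) * T ^ (k - 2) * (hull_diam Q)\<^sup>2
     + 2 * real k * T ^ (k - 1) * hull_const Q)"

text \<open>A member of a block has zero error against itself. ``Itself'' refers to the position in the
  block: if, say, the second and third members happen to be the same square, their mutual error is
  still \<^const>\<open>pair_error\<close>. (With zero error for such pairs the estimate fails: for
  \<^term>\<open>G k\<close> with large \<^term>\<open>k\<close> and three coinciding squares, three points in the square can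
  be spread out better than three of its vertices.) For blocks with different members, the lemma
  \<open>ERR_distinct\<close> below shows that it makes no difference.\<close>

fun block_member :: "block \<Rightarrow> nat \<Rightarrow> (real^2) set" where
  "block_member (Q0, Q1, Q2, Q3) i = [Q0, Q1, Q2, Q3] ! i"

definition cell_of :: "block \<Rightarrow> nat \<Rightarrow> cell" where
  "cell_of B j = (if j < 4 then Cell (block_member B j) else Infinity)"

definition block_error :: "nat \<Rightarrow> block \<Rightarrow> nat \<Rightarrow> nat \<Rightarrow> real" where
  "block_error k B i j = (if i = j then 0 else pair_error k (block_member B i) (cell_of B j))"

definition ERR :: "(nat \<Rightarrow> real) \<Rightarrow> nat \<Rightarrow> block \<Rightarrow> real" where
  "ERR a N B = (\<Sum>i = 0..3. \<Sum>j = 0..4. \<Sum>k = 1..N. \<bar>a k\<bar> * block_error k B i j)"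

subsection \<open>Sanity checks\<close>

lemma dyadic_interval_pos: "dyadic_interval x s \<Longrightarrow> s > 0"
  by (induction rule: dyadic_interval.induct) auto

lemma dyadic_box_pos: "dyadic_box x y s \<Longrightarrow> s > 0"
  by (induction rule: dyadic_box.induct) auto

lemma vec2_eq: "(vector [a, b] :: real^2) = vector [c, d] \<longleftrightarrow> a = c \<and> b = d"
  by (auto simp: vec_eq_iff forall_2)

lemma segment_not_square:
  assumes "dyadic_segment Q" "good_square Q"
  shows False
proof -
  from assms(1) obtain u t where Q: "Q = segment_vertices u t"
    by (auto simp: dyadic_segment_def)
  from assms(2) obtain x y s where "dyadic_box x y s" "Q = square_vertices x y s"
    by (auto simp: good_square_def)
  then have s: "s > 0" and "vector [x, y] \<in> Q" "vector [x, y + s] \<in> Q"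
    by (auto simp: square_vertices_def dyadic_box_pos)
  then show False
    using Q by (auto simp: segment_vertices_def vec2_eq)
qed

definition set_error :: "nat \<Rightarrow> (real^2) set \<Rightarrow> cell \<Rightarrow> real" where
  "set_error k Q Q' = (if Cell Q = Q' then 0 else pair_error k Q Q')"

lemma ERR_distinct:
  assumes B: "good_block B" "distinct (map (block_member B) [1, 2, 3])"
  shows "ERR a N B =
    (\<Sum>i = 0..3. \<Sum>j = 0..4. \<Sum>k = 1..N. \<bar>a k\<bar> * set_error k (block_member B i) (cell_of B j))"
proof -
  obtain Q0 Q1 Q2 Q3 where Q: "B = (Q0, Q1, Q2, Q3)"
    by (cases B)
  have ne: "Q0 \<noteq> Q1" "Q0 \<noteq> Q2" "Q0 \<noteq> Q3" "Q1 \<noteq> Q2" "Q1 \<noteq> Q3" "Q2 \<noteq> Q3"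
    using B segment_not_square by (auto simp: Q)
  have eq: "block_error k B i j = set_error k (block_member B i) (cell_of B j)"
    if "i \<in> {0..3}" "j \<in> {0..4}" for i j k
  proof -
    have i: "i = 0 \<or> i = 1 \<or> i = 2 \<or> i = 3" and j: "j = 0 \<or> j = 1 \<or> j = 2 \<or> j = 3 \<or> j = 4"
      using that by auto
    from i j have "i = j \<longleftrightarrow> Cell (block_member B i) = cell_of B j"
      by (elim disjE; use ne ne[symmetric] in \<open>simp add: Q cell_of_def\<close>)
    then show ?thesis
      by (simp add: block_error_def set_error_def)
  qed
  show ?thesis
    unfolding ERR_def by (intro sum.cong refl) (simp add: eq)
qed

lemma dist_vec2: "dist (z :: real^2) w = sqrt ((z$1 - w$1)\<^sup>2 + (z$2 - w$2)\<^sup>2)"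
  by (simp add: dist_vec_def L2_set_def sum_2 dist_real_def)

lemma vertex_disk_eqI:
  assumes "Q \<subseteq> sphere c r" "c \<in> convex hull Q"
    and "\<And>c' r'. Q \<subseteq> sphere c' r' \<Longrightarrow> c' \<in> convex hull Q \<Longrightarrow> c' = c \<and> r' = r"
  shows "vertex_disk Q = cball c r"
  unfolding vertex_disk_def using assms by (intro the_equality) blast+

lemma vertex_disk_segment:
  assumes "s > 0"
  shows "vertex_disk (segment_vertices x s) = cball (vector [x + s / 2, 0]) (s / 2)"
proof (rule vertex_disk_eqI)
  let ?p = "vector [x, 0] :: real^2" and ?q = "vector [x + s, 0] :: real^2"
  show "segment_vertices x s \<subseteq> sphere (vector [x + s / 2, 0]) (s / 2)"
    using assms by (auto simp: segment_vertices_def dist_vec2)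
  have "vector [x + s / 2, 0] = (1 - 1 / 2) *\<^sub>R ?p + (1 / 2) *\<^sub>R ?q"
    by (simp add: vec_eq_iff forall_2 field_simps)
  then show "vector [x + s / 2, 0] \<in> convex hull segment_vertices x s"
    unfolding segment_vertices_def segment_convex_hull[symmetric] in_segment
    by (intro exI[of _ "1 / 2"]) auto
  fix c r
  assume sub: "segment_vertices x s \<subseteq> sphere c r" and "c \<in> convex hull segment_vertices x s"
  then obtain u where c: "c = (1 - u) *\<^sub>R ?p + u *\<^sub>R ?q" and u: "0 \<le> u" "u \<le> 1"
    by (auto simp: segment_vertices_def segment_convex_hull[symmetric] in_segment)
  have c12: "c$1 = x + u * s" "c$2 = 0"
    by (auto simp: c algebra_simps)
  have "r = \<bar>u * s\<bar>" "r = \<bar>u * s - s\<bar>"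
    using sub by (auto simp: segment_vertices_def dist_vec2 c12)
  moreover have "0 \<le> u * s" "u * s \<le> s"
    using u assms by (auto simp: mult_left_le_one_le)
  ultimately have "r = u * s" "r = s - u * s"
    by auto
  then have r: "r = s / 2" and "u * s = (1 / 2) * s"
    by auto
  then have "u = 1 / 2"
    using assms by (metis less_irrefl mult_cancel_right)
  then show "c = vector [x + s / 2, 0] \<and> r = s / 2"
    by (simp add: vec_eq_iff forall_2 c12 r)
qed

lemma vertex_disk_square:
  assumes "s > 0"
  shows "vertex_disk (square_vertices x y s) =
    cball (vector [x + s / 2, y + s / 2]) (s / sqrt 2)"
proof (rule vertex_disk_eqI)
  let ?p = "vector [x, y] :: real^2" and ?q = "vector [x + s, y + s] :: real^2"
  have rad: "sqrt ((s / 2)\<^sup>2 + (s / 2)\<^sup>2) = s / sqrt 2"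
    using assms by (intro real_sqrt_unique) (auto simp: power_divide)
  show "square_vertices x y s \<subseteq> sphere (vector [x + s / 2, y + s / 2]) (s / sqrt 2)"
    by (auto simp: square_vertices_def dist_vec2 simp flip: rad)
  have "vector [x + s / 2, y + s / 2] = (1 - 1 / 2) *\<^sub>R ?p + (1 / 2) *\<^sub>R ?q"
    by (simp add: vec_eq_iff forall_2 field_simps)
  then have "vector [x + s / 2, y + s / 2] \<in> convex hull {?p, ?q}"
    unfolding segment_convex_hull[symmetric] in_segment by (intro exI[of _ "1 / 2"]) auto
  then show "vector [x + s / 2, y + s / 2] \<in> convex hull square_vertices x y s"
    using hull_mono[of "{?p, ?q}" "square_vertices x y s" convex]
    by (auto simp: square_vertices_def)
  fix c r
  assume "square_vertices x y s \<subseteq> sphere c r"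
  then have r: "r = sqrt ((c$1 - x)\<^sup>2 + (c$2 - y)\<^sup>2)"
      "r = sqrt ((c$1 - (x + s))\<^sup>2 + (c$2 - y)\<^sup>2)"
      "r = sqrt ((c$1 - x)\<^sup>2 + (c$2 - (y + s))\<^sup>2)"
    by (auto simp: square_vertices_def dist_vec2)
  then have "(c$1 - x)\<^sup>2 = (c$1 - (x + s))\<^sup>2" "(c$2 - y)\<^sup>2 = (c$2 - (y + s))\<^sup>2"
    by simp_all
  then have c: "c$1 = x + s / 2" "c$2 = y + s / 2"
    using assms by (auto simp: power2_eq_iff)
  with r(1) show "c = vector [x + s / 2, y + s / 2] \<and> r = s / sqrt 2"
    by (simp only: vec_eq_iff forall_2 vector_2) (simp flip: rad)
qed

lemma continuous_on_inv_stereo: "continuous_on S inv_stereo"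
proof -
  have "1 + (z$1)\<^sup>2 + (z$2)\<^sup>2 > 0" for z :: "real^2"
    by (simp add: add_pos_nonneg)
  then have nz: "1 + (z$1)\<^sup>2 + (z$2)\<^sup>2 \<noteq> 0" for z :: "real^2"
    by (metis less_irrefl)
  have vec3: "(vector [p, q, r] :: real^3) = (\<chi> i. if i = 1 then p else if i = 2 then q else (r::real))"
    for p q r :: real
    by (simp add: vec_eq_iff forall_3 vector_3)
  have if_cont: "continuous_on S (\<lambda>z. if b then f z else g z)"
    if "continuous_on S f" "continuous_on S g" for b and f g :: "real^2 \<Rightarrow> real"
    using that by (cases b) auto
  show ?thesis
    unfolding inv_stereo_def Let_def vec3
    by (intro continuous_on_vec_lambda if_cont continuous_intros) (auto simp: nz)
qed

lemma energy_attains_min: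
  assumes "good_block B"
  shows "\<exists>v \<in> block_solid B.
    (INF u \<in> block_solid B. energy (potential a N) u) = energy (potential a N) v"
proof -
  obtain Q0 Q1 Q2 Q3 where B: "B = (Q0, Q1, Q2, Q3)"
    by (cases B)
  have fin: "finite Q0 \<and> finite Q1 \<and> finite Q2 \<and> finite Q3 \<and>
      Q0 \<noteq> {} \<and> Q1 \<noteq> {} \<and> Q2 \<noteq> {} \<and> Q3 \<noteq> {}"
    using assms by (auto simp: B dyadic_segment_def good_square_def segment_vertices_def square_vertices_def)
  have hat_cont: "continuous_on S (\<lambda>v. hat (Some (f v)))"
    if "continuous_on S f" for S and f :: "config \<Rightarrow> real^2"
    using continuous_on_compose2[OF continuous_on_inv_stereo[of UNIV] that] by simp
  define P where "P i v = hat ([Some (fst v), Some (fst (snd v)),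
      Some (fst (snd (snd v))), Some (snd (snd (snd v))), None] ! i)" for i and v :: config
  have P_cont: "continuous_on S (P i)" if "i \<le> 4" for i S
  proof -
    have "P 0 = (\<lambda>v. hat (Some (fst v)))" "P 1 = (\<lambda>v. hat (Some (fst (snd v))))"
      "P 2 = (\<lambda>v. hat (Some (fst (snd (snd v)))))" "P 3 = (\<lambda>v. hat (Some (snd (snd (snd v)))))"
      "P 4 = (\<lambda>v. hat None)"
      by (simp_all add: P_def fun_eq_iff del: hat.simps)
    moreover have "continuous_on S (\<lambda>v. hat (Some (fst v)))"
      "continuous_on S (\<lambda>v. hat (Some (fst (snd v))))"
      "continuous_on S (\<lambda>v. hat (Some (fst (snd (snd v)))))"
      "continuous_on S (\<lambda>v. hat (Some (snd (snd (snd v)))))"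
      by (rule hat_cont; intro continuous_intros)+
    moreover have "i = 0 \<or> i = 1 \<or> i = 2 \<or> i = 3 \<or> i = 4"
      using \<open>i \<le> 4\<close> by linarith
    ultimately show ?thesis
      by (auto simp del: hat.simps)
  qed
  have E: "energy (potential a N) = (\<lambda>v. \<Sum>j = 0..4. \<Sum>i<j. \<Sum>k = 1..N.
      a k * (4 - (norm (P i v - P j v))\<^sup>2) ^ k)"
    unfolding energy_def potential_def G_def P_def Let_def case_prod_beta ..
  have comp: "compact (block_solid B)"
    using fin by (simp add: B compact_Times finite_imp_compact_convex_hull)
  have ne: "block_solid B \<noteq> {}"
    using fin by (simp add: B)
  have cont: "continuous_on (block_solid B) (energy (potential a N))"
    unfolding E
    by (intro continuous_on_sum continuous_on_mult continuous_on_power continuous_on_diff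
        continuous_on_norm continuous_on_const P_cont) auto
  obtain v where v: "v \<in> block_solid B"
      and min: "\<forall>u \<in> block_solid B. energy (potential a N) v \<le> energy (potential a N) u"
    using continuous_attains_inf[OF comp ne cont] by (elim bexE)
  have "(INF u \<in> block_solid B. energy (potential a N) u) = energy (potential a N) v"
    using v min by (intro cInf_eq_minimum) (auto simp del: split_paired_Ex split_paired_All)
  with v show ?thesis
    by (intro bexI)
qed

end

theory Submission
  imports Defs
begin

text \<open>
  For unit vectors, \<open>G k (norm (p - q)) = (2 + 2 * (p \<bullet> q)) ^ k\<close>, so each pair of points contributes
  a polynomial in one inner product, and as a function of a single point the energy is a
  polynomial in finitely many linear functionals of its image on the sphere.

  The image of a point \<open>z\<close> of a solid cell is within \<^const>\<open>hull_const\<close> of some point \<open>p\<close> of the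
  convex hull of the images of the vertices (\<open>hull_approx\<close>). Writing \<open>p\<close> as a convex combination
  of those images yields weights on the vertices. Replacing \<open>z\<close> by a vertex chosen at random with
  these weights changes the expectation of the \<open>k\<close>-th power in two ways: the second-order Taylor
  bound and the variance bound of Popoviciu give the term with the squared hull diameter, and the
  displacement of \<open>z\<close> to \<open>p\<close> gives the term with \<^const>\<open>hull_const\<close>
  (\<open>average_power_diff\<close>, \<open>pair_average\<close>). Hence some vertex
  increases the energy by less than the sum of the errors of that cell against the other four
  (\<open>vertex_step\<close>); as the deviations are bounded in absolute value, coefficients of either sign
  are covered. Starting at a minimiser and replacing the four finite points one after the other
  ends at a vertex of the block, and the errors add up to \<^const>\<open>ERR\<close>.

  The geometric heart is \<open>hull_approx\<close>. Let \<open>F\<close> be the point of the vertex hull nearest to the image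
  of \<open>z\<close>, and let \<open>w\<close> be the difference. For a square, the four vertices lie on a circle, so their
  images are coplanar. If \<open>F\<close> is in the relative interior, \<open>w\<close> is normal to that
  plane and the bound is the height of a spherical cap (\<open>interior_approx\<close>). If \<open>F\<close> is
  on an edge, \<open>w\<close> lies in the cone
  spanned by this normal and the direction perpendicular to the edge in the plane of the circle
  that is the image of the side; on both rays, \<open>w \<bullet> F\<close> is at least half the norm, hence also inside the cone, and then
  \<open>1 = norm F ^ 2 + 2 * (w \<bullet> F) + norm w ^ 2\<close> bounds the norm of \<open>w\<close> by a quarter of the squared edge
  (\<open>edge_cone\<close>, \<open>edge_approx\<close>). A vertex is nearest only to itself, because the chord from it to
  any other image makes an acute angle with one of the adjacent edges (\<open>corner_acute\<close>). For a segment,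
  everything happens on a great circle, and the bound is the height of an arc over its chord
  (\<open>segment_hull_approx\<close>).
\<close>

section \<open>Averages of powers\<close>

lemma power_diff_le:
  fixes s t T :: real
  assumes "0 \<le> s" "s \<le> T" "0 \<le> t" "t \<le> T"
  shows "\<bar>s ^ k - t ^ k\<bar> \<le> real k * T ^ (k - 1) * \<bar>s - t\<bar>"
proof (induction k)
  case (Suc k)
  have "\<bar>s ^ Suc k - t ^ Suc k\<bar> = \<bar>s * (s ^ k - t ^ k) + (s - t) * t ^ k\<bar>"
    by (simp add: algebra_simps)
  also have "\<dots> \<le> s * \<bar>s ^ k - t ^ k\<bar> + \<bar>s - t\<bar> * t ^ k"
    using assms by (intro order_trans[OF abs_triangle_ineq]) (simp add: abs_mult)
  also have "s * \<bar>s ^ k - t ^ k\<bar> \<le> T * (real k * T ^ (k - 1) * \<bar>s - t\<bar>)"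
    using assms Suc by (intro mult_mono) auto
  also have "T * (real k * T ^ (k - 1) * \<bar>s - t\<bar>) = real k * T ^ k * \<bar>s - t\<bar>"
    by (cases k) auto
  also have "\<bar>s - t\<bar> * t ^ k \<le> \<bar>s - t\<bar> * T ^ k"
    using assms by (intro mult_left_mono power_mono) auto
  finally show ?case by (simp add: algebra_simps)
qed simp

text \<open>Both Taylor estimates go by induction on the exponent, multiplying the previous one by \<open>t\<close>: the
  product of \<open>t\<close> with the tangent line differs from the next tangent line by
  \<open>k * m ^ (k - 1) * (t - m)\<^sup>2\<close>.\<close>
lemma power_tangent_le:
  fixes m t :: real
  assumes "0 \<le> m" "0 \<le> t"
  shows "m ^ k + real k * m ^ (k - 1) * (t - m) \<le> t ^ k"
proof (induction k)
  case (Suc k)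
  have "m ^ Suc k + real (Suc k) * m ^ k * (t - m)
      = t * (m ^ k + real k * m ^ (k - 1) * (t - m)) - real k * m ^ (k - 1) * (t - m)\<^sup>2"
    by (cases k) (auto simp: algebra_simps power2_eq_square)
  also have "\<dots> \<le> t * (m ^ k + real k * m ^ (k - 1) * (t - m))"
    using assms by simp
  also have "\<dots> \<le> t * t ^ k"
    using Suc assms by (intro mult_left_mono)
  finally show ?case by simp
qed simp

lemma power_le_taylor2:
  fixes m t T :: real
  assumes "0 \<le> m" "m \<le> T" "0 \<le> t" "t \<le> T"
  shows "t ^ k \<le> m ^ k + real k * m ^ (k - 1) * (t - m)
    + 1 / 2 * real k * (real k - 1) * T ^ (k - 2) * (t - m)\<^sup>2"
proof (induction k)
  case (Suc k)
  define c where "c = 1 / 2 * real k * (real k - 1) * T ^ (k - 2)"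
  have c0: "0 \<le> c" using assms by (cases k) (auto simp: c_def)
  have "T * c = 1 / 2 * real k * (real k - 1) * T ^ (k - 1)"
    unfolding c_def by (cases k; cases "k - 1") auto
  moreover have "real k * m ^ (k - 1) \<le> real k * T ^ (k - 1)"
    using assms by (intro mult_left_mono power_mono) auto
  moreover have "t * c \<le> T * c"
    using assms c0 by (intro mult_right_mono)
  ultimately have coef: "real k * m ^ (k - 1) + t * c \<le> 1 / 2 * real (Suc k) * real k * T ^ (k - 1)"
    by (simp add: algebra_simps add_divide_distrib)
  have "t ^ Suc k \<le> t * (m ^ k + real k * m ^ (k - 1) * (t - m) + c * (t - m)\<^sup>2)"
    using Suc assms by (simp add: c_def mult_left_mono)
  also have "\<dots> = m ^ Suc k + real (Suc k) * m ^ k * (t - m)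
      + (real k * m ^ (k - 1) + t * c) * (t - m)\<^sup>2"
    by (cases k) (auto simp: algebra_simps power2_eq_square)
  also have "\<dots> \<le> m ^ Suc k + real (Suc k) * m ^ k * (t - m)
      + (1 / 2 * real (Suc k) * real k * T ^ (k - 1)) * (t - m)\<^sup>2"
    using coef by (intro add_left_mono mult_right_mono) auto
  finally show ?case by (simp add: algebra_simps)
qed simp

text \<open>Popoviciu's inequality. The variance is at most the second moment about any other point,
  and about the midpoint of the range no value deviates by more than \<open>d\<close>.\<close>
lemma popoviciu:
  fixes t u :: "'a \<Rightarrow> real"
  assumes "finite S" "\<And>q. q \<in> S \<Longrightarrow> 0 \<le> u q" "sum u S = 1"
    and d: "\<And>q q'. q \<in> S \<Longrightarrow> q' \<in> S \<Longrightarrow> t q - t q' \<le> 2 * d"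
    and m: "m = (\<Sum>q\<in>S. u q * t q)"
  shows "(\<Sum>q\<in>S. u q * (t q - m)\<^sup>2) \<le> d\<^sup>2"
proof -
  have ne: "S \<noteq> {}" using assms(3) by auto
  have im: "finite (t ` S)" "t ` S \<noteq> {}" using assms(1) ne by auto
  obtain q0 where q0: "q0 \<in> S" and lo: "\<And>q. q \<in> S \<Longrightarrow> t q0 \<le> t q"
    using Min_in[OF im] Min_le[OF im(1)] by auto
  obtain q1 where q1: "q1 \<in> S" and hi: "\<And>q. q \<in> S \<Longrightarrow> t q \<le> t q1"
    using Max_in[OF im] Max_ge[OF im(1)] by auto
  define c where "c = (t q0 + t q1) / 2"
  have "\<bar>t q - c\<bar> \<le> d" if "q \<in> S" for q
    using lo[OF that] hi[OF that] d[OF q1 q0] by (simp add: c_def abs_le_iff field_simps)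
  then have "(t q - c)\<^sup>2 \<le> d\<^sup>2" if "q \<in> S" for q
    using that by (metis abs_ge_zero order_trans power2_abs power_mono)
  then have "(\<Sum>q\<in>S. u q * (t q - c)\<^sup>2) \<le> (\<Sum>q\<in>S. u q * d\<^sup>2)"
    using assms(2) by (intro sum_mono mult_left_mono) auto
  also have "\<dots> = d\<^sup>2" using assms(3) by (simp flip: sum_distrib_right)
  finally have "(\<Sum>q\<in>S. u q * (t q - c)\<^sup>2) \<le> d\<^sup>2" .
  moreover have "(\<Sum>q\<in>S. u q * (t q - m)\<^sup>2) = (\<Sum>q\<in>S. u q * (t q - c)\<^sup>2) - (m - c)\<^sup>2"
  proof -
    have "(\<Sum>q\<in>S. u q * (t q - m)\<^sup>2)
        = (\<Sum>q\<in>S. u q * (t q - c)\<^sup>2 - 2 * (m - c) * (u q * t q) + (m\<^sup>2 - c\<^sup>2) * u q)"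
      by (intro sum.cong) (auto simp: algebra_simps power2_eq_square)
    also have "\<dots> = (\<Sum>q\<in>S. u q * (t q - c)\<^sup>2) - 2 * (m - c) * m + (m\<^sup>2 - c\<^sup>2)"
      using assms(3) m by (simp add: sum.distrib sum_subtractf flip: sum_distrib_left)
    finally show ?thesis by (simp add: algebra_simps power2_eq_square)
  qed
  ultimately show ?thesis by (smt (verit) zero_le_power2)
qed

text \<open>The average of the powers exceeds the power of the average \<open>m\<close> by at most half the second
  derivative times the variance, and \<open>\<tau>\<close> is close to \<open>m\<close>. The term with \<open>T ^ (k - 2)\<close> vanishes
  for \<open>k = 1\<close>, whatever the truncated exponent.\<close>
lemma average_power_diff:
  fixes t u :: "'a \<Rightarrow> real"
  assumes "finite S" "\<And>q. q \<in> S \<Longrightarrow> 0 \<le> u q" "sum u S = 1"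
    and t: "\<And>q. q \<in> S \<Longrightarrow> 0 \<le> t q \<and> t q \<le> T"
    and d: "\<And>q q'. q \<in> S \<Longrightarrow> q' \<in> S \<Longrightarrow> t q - t q' \<le> 2 * d"
    and \<tau>: "0 \<le> \<tau>" "\<tau> \<le> T" "\<bar>\<tau> - (\<Sum>q\<in>S. u q * t q)\<bar> < 2 * \<delta>"
    and "0 < T" "1 \<le> k"
  shows "\<bar>(\<Sum>q\<in>S. u q * t q ^ k) - \<tau> ^ k\<bar>
    < 1 / 2 * real k * (real k - 1) * T ^ (k - 2) * d\<^sup>2 + 2 * real k * T ^ (k - 1) * \<delta>"
proof -
  define m where "m = (\<Sum>q\<in>S. u q * t q)"
  define c where "c = 1 / 2 * real k * (real k - 1) * T ^ (k - 2)"
  have c0: "0 \<le> c" using assms by (auto simp: c_def)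
  have m0: "0 \<le> m" unfolding m_def using assms by (intro sum_nonneg) auto
  have "m \<le> (\<Sum>q\<in>S. u q * T)"
    unfolding m_def using assms by (intro sum_mono mult_left_mono) auto
  then have mT: "m \<le> T" using assms(3) by (simp flip: sum_distrib_right)
  \<comment> \<open>The linear Taylor term averages out, since \<open>m\<close> is the mean.\<close>
  have lin: "(\<Sum>q\<in>S. u q * (m ^ k + real k * m ^ (k - 1) * (t q - m))) = m ^ k"
  proof -
    have "(\<Sum>q\<in>S. u q * (m ^ k + real k * m ^ (k - 1) * (t q - m)))
       = (\<Sum>q\<in>S. (m ^ k - real k * m ^ (k - 1) * m) * u q + real k * m ^ (k - 1) * (u q * t q))"
      by (intro sum.cong) (auto simp: algebra_simps)
    also have "\<dots> = (m ^ k - real k * m ^ (k - 1) * m) + real k * m ^ (k - 1) * m"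
      using assms(3) by (simp add: sum.distrib m_def flip: sum_distrib_left)
    finally show ?thesis by simp
  qed
  have lower: "m ^ k \<le> (\<Sum>q\<in>S. u q * t q ^ k)"
    using assms m0 by (subst lin[symmetric], intro sum_mono mult_left_mono power_tangent_le) auto
  have "(\<Sum>q\<in>S. u q * t q ^ k)
      \<le> (\<Sum>q\<in>S. u q * (m ^ k + real k * m ^ (k - 1) * (t q - m) + c * (t q - m)\<^sup>2))"
    unfolding c_def using assms m0 mT by (intro sum_mono mult_left_mono power_le_taylor2) auto
  also have "\<dots> = m ^ k + c * (\<Sum>q\<in>S. u q * (t q - m)\<^sup>2)"
    unfolding sum_distrib_left by (subst (2) lin[symmetric]) (simp add: algebra_simps sum.distrib sum_subtractf)
  also have "\<dots> \<le> m ^ k + c * d\<^sup>2"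
    using c0 popoviciu[OF assms(1-3) d m_def] by (intro add_left_mono mult_left_mono) auto
  finally have upper: "(\<Sum>q\<in>S. u q * t q ^ k) \<le> m ^ k + c * d\<^sup>2" .
  have "\<bar>m ^ k - \<tau> ^ k\<bar> \<le> real k * T ^ (k - 1) * \<bar>m - \<tau>\<bar>"
    using m0 mT \<tau> by (intro power_diff_le)
  also have "\<dots> < real k * T ^ (k - 1) * (2 * \<delta>)"
    using \<tau>(3) assms by (intro mult_strict_left_mono) (auto simp: m_def abs_minus_commute)
  finally show ?thesis
    using lower upper unfolding c_def by (simp add: abs_le_iff abs_less_iff)
qed

section \<open>Inverse stereographic projection\<close>

text \<open>The denominator of \<^const>\<open>inv_stereo\<close>. Multiplied by it, an inner product with a point of the
  sphere becomes a quadratic polynomial of the point of the plane, whose quadratic part is a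
  multiple of the squared norm. All estimates below compare such polynomials at the vertices and
  at a point of the cell.\<close>
definition denom :: "real^2 \<Rightarrow> real" where "denom z = 1 + (z$1)\<^sup>2 + (z$2)\<^sup>2"

lemma denom_ge_1: "1 \<le> denom z" by (simp add: denom_def)
lemma denom_pos: "0 < denom z" using denom_ge_1[of z] by linarith

lemma inv_stereo_nth:
  "inv_stereo z $ 1 = 2 * z$1 / denom z" "inv_stereo z $ 2 = 2 * z$2 / denom z"
  "inv_stereo z $ 3 = 1 - 2 / denom z"
  by (simp_all add: inv_stereo_def denom_def Let_def vector_3)

lemma inner_vec2: "(v::real^2) \<bullet> w = v$1 * w$1 + v$2 * w$2"
  by (simp add: inner_vec_def sum_2)

lemma inner_vec3: "(v::real^3) \<bullet> w = v$1 * w$1 + v$2 * w$2 + v$3 * w$3"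
  by (simp add: inner_vec_def sum_3)

lemma denom_inner_inv_stereo:
  "denom z * (w \<bullet> inv_stereo z) = 2 * z$1 * w$1 + 2 * z$2 * w$2 + ((z$1)\<^sup>2 + (z$2)\<^sup>2 - 1) * w$3"
proof -
  have "denom z * (w \<bullet> inv_stereo z) = 2 * z$1 * w$1 + 2 * z$2 * w$2 + (denom z - 2) * w$3"
    using denom_pos[of z] by (simp add: inner_vec3 inv_stereo_nth field_simps)
  then show ?thesis by (simp add: denom_def)
qed

lemma inner_inv_stereo:
  "inv_stereo y \<bullet> inv_stereo z = 1 - 2 * (dist y z)\<^sup>2 / (denom y * denom z)"
proof -
  have "denom y * (denom z * (inv_stereo y \<bullet> inv_stereo z))
    = 2 * z$1 * (denom y * inv_stereo y$1) + 2 * z$2 * (denom y * inv_stereo y$2)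
      + ((z$1)\<^sup>2 + (z$2)\<^sup>2 - 1) * (denom y * inv_stereo y$3)"
    by (simp only: denom_inner_inv_stereo) (simp add: algebra_simps)
  also have "\<dots> = 2 * z$1 * (2 * y$1) + 2 * z$2 * (2 * y$2)
      + ((z$1)\<^sup>2 + (z$2)\<^sup>2 - 1) * (denom y - 2)"
    using denom_pos[of y] by (simp add: inv_stereo_nth right_diff_distrib)
  also have "\<dots> = denom y * denom z - 2 * (dist y z)\<^sup>2"
    by (simp add: denom_def dist_vec2 real_sqrt_pow2) (simp add: algebra_simps power2_eq_square)
  finally show ?thesis
    using denom_pos[of y] denom_pos[of z] by (simp add: field_simps)
qed

lemma norm_inv_stereo [simp]: "norm (inv_stereo z) = 1"
  using inner_inv_stereo[of z z] by (simp add: norm_eq_1)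

lemma dist_inv_stereo:
  "(dist (inv_stereo y) (inv_stereo z))\<^sup>2 = 4 * (dist y z)\<^sup>2 / (denom y * denom z)"
proof -
  have "(dist (inv_stereo y) (inv_stereo z))\<^sup>2 = 2 - 2 * (inv_stereo y \<bullet> inv_stereo z)"
    using dot_norm_neg[of "inv_stereo y" "inv_stereo z"] by (simp add: dist_norm)
  then show ?thesis by (simp add: inner_inv_stereo)
qed

lemma inj_inv_stereo: "inj inv_stereo"
proof (rule injI)
  fix y z assume "inv_stereo y = inv_stereo z"
  then have "4 * (dist y z)\<^sup>2 / (denom y * denom z) = 0"
    using dist_inv_stereo[of y z] by simp
  then show "y = z" using denom_pos[of y] denom_pos[of z] by simp
qed

lemma inner_chords:
  "(inv_stereo z - inv_stereo q) \<bullet> (inv_stereo y - inv_stereo q)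
    = 2 * (denom y * (dist z q)\<^sup>2 + denom z * (dist q y)\<^sup>2 - denom q * (dist z y)\<^sup>2)
      / (denom z * denom q * denom y)"
proof -
  have "(inv_stereo z - inv_stereo q) \<bullet> (inv_stereo y - inv_stereo q) = 2 * (dist z q)\<^sup>2 / (denom z * denom q)
      + 2 * (dist q y)\<^sup>2 / (denom q * denom y) - 2 * (dist z y)\<^sup>2 / (denom z * denom y)"
    by (simp add: inner_diff_left inner_diff_right inner_inv_stereo)
  also have "\<dots> = 2 * (denom y * (dist z q)\<^sup>2 + denom z * (dist q y)\<^sup>2 - denom q * (dist z y)\<^sup>2)
      / (denom z * denom q * denom y)"
    using denom_pos[of z] denom_pos[of q] denom_pos[of y] by (simp add: field_simps)
  finally show ?thesis .
qed

text \<open>Seen from the image of a corner of a square, no other point of the square can be behind both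
  adjacent edges. A combination of the two inner products with positive coefficients is \<open>\<sigma>\<^sup>2 * K\<close>,
  where \<open>K\<close> is at least linear in the relative coordinates \<open>l\<close> and \<open>\<mu>\<close>, with a coefficient bounded
  below by completing squares. The signs of \<open>\<sigma>\<close> and \<open>\<tau>\<close> select which of the four corners \<open>q\<close> is.\<close>
lemma corner_acute:
  fixes z q q1 q2 :: "real^2"
  assumes "q$1 = a" "q$2 = b" "q1$1 = a + \<sigma>" "q1$2 = b" "q2$1 = a" "q2$2 = b + \<tau>"
    and "z$1 = a + l * \<sigma>" "z$2 = b + \<mu> * \<tau>" "\<sigma>\<^sup>2 = \<tau>\<^sup>2" "\<tau>\<^sup>2 \<le> 1 / 4"
    and "0 \<le> l" "l \<le> 1" "0 \<le> \<mu>" "\<mu> \<le> 1" "z \<noteq> q"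
  shows "0 < (inv_stereo z - inv_stereo q) \<bullet> (inv_stereo q1 - inv_stereo q)
    \<or> 0 < (inv_stereo z - inv_stereo q) \<bullet> (inv_stereo q2 - inv_stereo q)"
proof -
  define H where "H y = denom y * (dist z q)\<^sup>2 + denom z * (dist q y)\<^sup>2 - denom q * (dist z y)\<^sup>2" for y
  have H: "0 < (inv_stereo z - inv_stereo q) \<bullet> (inv_stereo y - inv_stereo q)" if "0 < H y" for y
    using that denom_pos by (simp add: inner_chords H_def)
  have d2: "(dist x y)\<^sup>2 = (x$1 - y$1)\<^sup>2 + (x$2 - y$2)\<^sup>2" for x y :: "real^2"
    by (simp add: dist_vec2)
  have \<sigma>0: "0 < \<sigma>\<^sup>2" using assms(7-9) \<open>z \<noteq> q\<close> assms(1,2) by (auto simp: vec_eq_iff forall_2)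
  have lm: "0 < l + \<mu>" using assms(7,8,11,13) \<open>z \<noteq> q\<close> assms(1,2)
    by (cases "l = 0"; cases "\<mu> = 0") (auto simp: vec_eq_iff forall_2)
  define K where "K = 2 * (1 + a\<^sup>2 + b\<^sup>2) * (l + \<mu>) + 4 * (a * \<sigma>) * l + 4 * (b * \<tau>) * \<mu>
      + (2 * (a * \<sigma>) + 2 * (b * \<tau>) + 4 * \<sigma>\<^sup>2) * (l\<^sup>2 + \<mu>\<^sup>2)"
  have "H q1 = (2 * a * \<sigma> + \<sigma>\<^sup>2) * (l\<^sup>2 * \<sigma>\<^sup>2 + \<mu>\<^sup>2 * \<tau>\<^sup>2)
      + \<sigma>\<^sup>2 * (2 * a * l * \<sigma> + l\<^sup>2 * \<sigma>\<^sup>2 + 2 * b * \<mu> * \<tau> + \<mu>\<^sup>2 * \<tau>\<^sup>2)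
      + 2 * (1 + a\<^sup>2 + b\<^sup>2) * l * \<sigma>\<^sup>2"
    by (simp add: H_def d2 denom_def assms(1-8)) (simp add: algebra_simps power2_eq_square)
  moreover have "H q2 = (2 * b * \<tau> + \<tau>\<^sup>2) * (l\<^sup>2 * \<sigma>\<^sup>2 + \<mu>\<^sup>2 * \<tau>\<^sup>2)
      + \<tau>\<^sup>2 * (2 * a * l * \<sigma> + l\<^sup>2 * \<sigma>\<^sup>2 + 2 * b * \<mu> * \<tau> + \<mu>\<^sup>2 * \<tau>\<^sup>2)
      + 2 * (1 + a\<^sup>2 + b\<^sup>2) * \<mu> * \<tau>\<^sup>2"
    by (simp add: H_def d2 denom_def assms(1-8)) (simp add: algebra_simps power2_eq_square)
  ultimately have HK: "H q1 + H q2 = \<sigma>\<^sup>2 * K"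
    unfolding K_def assms(9)[symmetric] by (simp add: algebra_simps)
  have half: "\<bar>\<sigma>\<bar> \<le> 1 / 2" "\<bar>\<tau>\<bar> \<le> 1 / 2"
    using assms(9,10) abs_le_square_iff[of \<sigma> "1 / 2"] abs_le_square_iff[of \<tau> "1 / 2"]
    by (auto simp: power2_eq_square)
  have ab: "- (\<bar>a\<bar> / 2) \<le> a * \<sigma>" "- (\<bar>b\<bar> / 2) \<le> b * \<tau>"
    using mult_left_mono[OF half(1), of "\<bar>a\<bar>"] mult_left_mono[OF half(2), of "\<bar>b\<bar>"]
    by (auto simp: abs_mult[symmetric] abs_le_iff)
  have sq: "l\<^sup>2 + \<mu>\<^sup>2 \<le> l + \<mu>" "0 \<le> l\<^sup>2 + \<mu>\<^sup>2"
    using assms(11-14) by (auto simp: power2_eq_square mult_left_le intro!: add_mono)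
  have "- (\<bar>a\<bar> + \<bar>b\<bar>) * (l + \<mu>) \<le> - (\<bar>a\<bar> + \<bar>b\<bar>) * (l\<^sup>2 + \<mu>\<^sup>2)"
    using sq by (intro mult_left_mono_neg) auto
  also have "\<dots> \<le> (2 * (a * \<sigma>) + 2 * (b * \<tau>) + 4 * \<sigma>\<^sup>2) * (l\<^sup>2 + \<mu>\<^sup>2)"
    using sq(2) ab zero_le_power2[of \<sigma>] by (intro mult_right_mono) linarith+
  finally have *: "- (\<bar>a\<bar> + \<bar>b\<bar>) * (l + \<mu>) \<le> \<dots>" .
  have "- (2 * \<bar>a\<bar>) * l \<le> 4 * (a * \<sigma>) * l" "- (2 * \<bar>b\<bar>) * \<mu> \<le> 4 * (b * \<tau>) * \<mu>"
    using ab assms(11-14) by (intro mult_right_mono; linarith)+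
  with * have "(2 + 2 * a\<^sup>2 + 2 * b\<^sup>2 - 3 * \<bar>a\<bar> - \<bar>b\<bar>) * l + (2 + 2 * a\<^sup>2 + 2 * b\<^sup>2 - \<bar>a\<bar> - 3 * \<bar>b\<bar>) * \<mu> \<le> K"
    unfolding K_def by (simp add: algebra_simps)
  moreover have pos: "3 / 4 \<le> 2 + 2 * x\<^sup>2 + 2 * y\<^sup>2 - 3 * \<bar>x\<bar> - \<bar>y\<bar>" for x y :: real
  proof -
    have "2 + 2 * x\<^sup>2 + 2 * y\<^sup>2 - 3 * \<bar>x\<bar> - \<bar>y\<bar> = 3 / 4 + 2 * (\<bar>x\<bar> - 3 / 4)\<^sup>2 + 2 * (\<bar>y\<bar> - 1 / 4)\<^sup>2"
      by (simp add: power2_diff algebra_simps) (simp add: power2_eq_square)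
    then show ?thesis by simp
  qed
  moreover have "3 / 4 * l \<le> (2 + 2 * a\<^sup>2 + 2 * b\<^sup>2 - 3 * \<bar>a\<bar> - \<bar>b\<bar>) * l"
    using pos[of a b] assms(11) by (intro mult_right_mono) auto
  moreover have "3 / 4 * \<mu> \<le> (2 + 2 * a\<^sup>2 + 2 * b\<^sup>2 - \<bar>a\<bar> - 3 * \<bar>b\<bar>) * \<mu>"
    using pos[of b a] assms(13) by (intro mult_right_mono) auto
  ultimately have "0 < K" using lm by linarith
  then have "0 < H q1 + H q2" using \<sigma>0 HK by simp
  then have "0 < H q1 \<or> 0 < H q2" by linarith
  then show ?thesis using H by blast
qed

text \<open>A cap of the unit sphere cut off at distance \<open>\<rho>\<close> from the centre has height \<open>1 - \<rho>\<close> and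
  diameter \<open>2 * sqrt (1 - \<rho>\<^sup>2)\<close>; the exact height is expressed by a square root that
  \<^const>\<open>chi\<close> bounds by a polynomial.\<close>
lemma chi_sagitta:
  assumes "0 \<le> \<rho>" "\<rho> < 1" "4 * (1 - \<rho>\<^sup>2) \<le> d\<^sup>2"
  shows "1 - \<rho> < chi 2 d"
proof -
  define u where "u = 1 - \<rho>\<^sup>2"
  have u: "0 \<le> u" "u \<le> d\<^sup>2 / 4" using assms by (auto simp: u_def power_le_one abs_square_le_1)
  have "0 < (1 - \<rho>) * (2 * (1 + \<rho>)\<^sup>2 - 1)"
    using assms by (intro mult_pos_pos) (auto simp: power2_sum algebra_simps add_pos_nonneg)
  then have "0 < (1 - \<rho>) * (1 - \<rho>) * (2 * (1 + \<rho>)\<^sup>2 - 1)"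
    using assms by (simp add: mult.assoc)
  also have "\<dots> = 2 * (u / 2 + u\<^sup>2 - (1 - \<rho>))"
    by (simp add: u_def field_simps power2_eq_square)
  finally have "1 - \<rho> < u / 2 + u\<^sup>2" by simp
  also have "\<dots> \<le> (d\<^sup>2 / 4) / 2 + (d\<^sup>2 / 4)\<^sup>2"
    using u by (intro add_mono divide_right_mono power_mono) auto
  also have "\<dots> = chi 2 d" by (simp add: chi_def power2_eq_square power4_eq_xxxx field_simps)
  finally show ?thesis .
qed

section \<open>Directions perpendicular to an edge\<close>

text \<open>The vector \<open>w = (w1, w2, w3)\<close> goes from a point \<open>F\<close> of an edge to the image of \<open>z\<close>, and
  \<open>\<kappa> = w \<bullet> F\<close>. The polynomial \<open>\<Lambda> a b\<close> is \<open>w \<bullet> (inv_stereo y - F)\<close> for \<open>y = (a, b)\<close>, multiplied by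
  the denominator at \<open>y\<close>. The side lies on the line with first coordinate \<open>p\<close>; it joins
  \<open>(p, q)\<close> to \<open>(p, q + \<tau>)\<close>, the square extends from it by \<open>\<sigma>\<close>, and \<open>l\<close>, \<open>\<mu>\<close> are the relative
  coordinates of \<open>z\<close>. The equations on \<open>\<Lambda>\<close> say that \<open>w\<close> is perpendicular to the
  edge. The last assumption says that \<open>w\<close> points to the inner side of the
  plane through the north pole that contains the image of the line.

  The vectors perpendicular to the edge form a plane, with coordinates \<open>k\<close> and \<open>\<omega>\<close>. There \<open>w\<close> is
  confined to a cone: on the ray \<open>\<omega> = 0\<close> it is parallel to the plane of the image of the line, and
  on the ray \<open>\<omega> = v\<close> it is normal to the plane of the four vertices. On both rays the norm is at most
  \<open>2 * \<kappa>\<close>. As the norm is convex and \<open>\<kappa>\<close> linear, this extends to the cone.\<close>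
lemma edge_cone:
  fixes p q \<sigma> \<tau> l \<mu> w1 w2 w3 \<kappa> :: real
  defines "\<Lambda> \<equiv> \<lambda>a b. 2 * a * w1 + 2 * b * w2 + (a\<^sup>2 + b\<^sup>2 - 1) * w3 - (1 + a\<^sup>2 + b\<^sup>2) * \<kappa>"
  assumes size: "\<sigma>\<^sup>2 = \<tau>\<^sup>2" "\<tau>\<^sup>2 \<le> 1 / 4" "\<sigma> \<noteq> 0" "\<bar>p\<bar> \<le> 3 / 2"
    and A: "\<Lambda> p q = 0" and B: "\<Lambda> p (q + \<tau>) = 0" and C: "\<Lambda> (p + \<sigma>) q \<le> 0"
    and lm: "0 \<le> l" "l \<le> 1" "0 \<le> \<mu>" "\<mu> \<le> 1"
    and Z: "0 < \<Lambda> (p + l * \<sigma>) (q + \<mu> * \<tau>)"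
    and S: "0 \<le> \<sigma> * (w1 + p * w3)"
  shows "0 \<le> \<kappa> \<and> w1\<^sup>2 + w2\<^sup>2 + w3\<^sup>2 \<le> 4 * \<kappa>\<^sup>2"
proof -
  define k where "k = \<kappa> - w3"
  define T where "T = 1 + p\<^sup>2"
  define g where "g = q * (q + \<tau>)"
  define \<alpha> where "\<alpha> = p * (T - g) / (2 * T)"
  define \<omega> where "\<omega> = w1 - k * \<alpha>"
  define v where "v = k * (p + \<sigma> / 2 - \<alpha>)"
  have T: "1 \<le> T" "T \<le> 13 / 4"
    using size(4) power_mono[of "\<bar>p\<bar>" "3 / 2" 2] by (auto simp: T_def power2_eq_square)
  have \<tau>0: "\<tau> \<noteq> 0" using size by auto
  have "\<tau> * (2 * w2 - k * (2 * q + \<tau>)) = \<Lambda> p (q + \<tau>) - \<Lambda> p q"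
    by (simp add: \<Lambda>_def k_def field_simps power2_eq_square)
  then have "2 * w2 = k * (2 * q + \<tau>)" using A B \<tau>0 by simp
  then have w2: "w2 = k * (q + \<tau> / 2)" by (simp add: field_simps)
  have w3: "2 * w3 = 2 * p * w1 - k * (T - g)"
  proof -
    have "2 * w3 = 2 * w3 + \<Lambda> p q - 2 * q * (w2 - k * (q + \<tau> / 2))"
      using A w2 by simp
    also have "\<dots> = 2 * p * w1 - k * (T - g)"
      by (simp add: \<Lambda>_def k_def T_def g_def field_simps power2_eq_square)
    finally show ?thesis .
  qed
  have Cs: "\<sigma> * (w1 - k * (p + \<sigma> / 2)) \<le> 0"
  proof -
    have "2 * (\<sigma> * (w1 - k * (p + \<sigma> / 2))) = \<Lambda> (p + \<sigma>) q - \<Lambda> p q"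
      by (simp add: \<Lambda>_def k_def field_simps power2_eq_square)
    then show ?thesis using A C by linarith
  qed
  have kpos: "0 < k"
  proof -
    have "\<Lambda> (p + l * \<sigma>) (q + \<mu> * \<tau>) = \<Lambda> (p + l * \<sigma>) (q + \<mu> * \<tau>) - (1 - \<mu>) * \<Lambda> p q - \<mu> * \<Lambda> p (q + \<tau>)"
      using A B by simp
    also have "\<dots> = 2 * l * (\<sigma> * (w1 - k * (p + \<sigma> / 2))) + k * (l * (1 - l) * \<sigma>\<^sup>2 + \<mu> * (1 - \<mu>) * \<tau>\<^sup>2)"
      by (simp add: \<Lambda>_def k_def field_simps power2_eq_square)
    also have "\<dots> \<le> k * (l * (1 - l) * \<sigma>\<^sup>2 + \<mu> * (1 - \<mu>) * \<tau>\<^sup>2)"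
      using mult_nonneg_nonpos[OF lm(1) Cs] by linarith
    finally have "0 < k * (l * (1 - l) * \<sigma>\<^sup>2 + \<mu> * (1 - \<mu>) * \<tau>\<^sup>2)" using Z by linarith
    moreover have "0 \<le> l * (1 - l) * \<sigma>\<^sup>2 + \<mu> * (1 - \<mu>) * \<tau>\<^sup>2" using lm by simp
    ultimately show ?thesis by (simp add: zero_less_mult_iff)
  qed
  have \<alpha>T: "2 * T * \<alpha> = p * (T - g)" using T by (simp add: \<alpha>_def)
  have S': "w1 + p * w3 = T * \<omega>"
  proof -
    have "2 * (w1 + p * w3) = 2 * w1 + p * (2 * p * w1 - k * (T - g))" by (simp flip: w3)
    also have "\<dots> = 2 * T * w1 - k * (p * (T - g))" by (simp add: T_def field_simps power2_eq_square)
    also have "\<dots> = 2 * (T * \<omega>)" unfolding \<alpha>T[symmetric] by (simp add: \<omega>_def field_simps)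
    finally show ?thesis by simp
  qed
  have s\<omega>: "0 \<le> \<sigma> * \<omega>"
  proof -
    have "0 \<le> T * (\<sigma> * \<omega>)" using S unfolding S' by (simp add: mult.left_commute)
    then show ?thesis using zero_le_mult_iff[of T "\<sigma> * \<omega>"] T by linarith
  qed
  have s\<omega>v: "\<sigma> * \<omega> \<le> \<sigma> * v"
    using Cs by (simp add: \<omega>_def v_def field_simps)
  obtain \<theta> where \<theta>: "\<omega> = \<theta> * v" "0 \<le> \<theta>" "\<theta> \<le> 1"
  proof (cases "v = 0")
    case True
    then have "\<omega> = 0" using s\<omega> s\<omega>v size(3) by (auto simp: zero_le_mult_iff mult_le_0_iff)
    then show ?thesis using that[of 0] by simp
  next
    case False
    then have "0 < \<sigma> * v" using s\<omega> s\<omega>v size(3) by (smt (verit) mult_eq_0_iff)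
    then have "0 \<le> \<sigma> * \<omega> / (\<sigma> * v)" "\<sigma> * \<omega> / (\<sigma> * v) \<le> 1"
      using s\<omega> s\<omega>v by (simp_all only: divide_nonneg_pos divide_le_eq_1_pos)
    moreover have "\<omega> = \<sigma> * \<omega> / (\<sigma> * v) * v" using size(3) False by simp
    ultimately show ?thesis using that by blast
  qed
  \<comment> \<open>The values of \<open>\<kappa>\<close> at the two ends of the segment of the cone through \<open>w\<close>; \<open>A0\<close> and
    \<open>A0 + T * v\<^sup>2\<close> are the squared norms there.\<close>
  define \<kappa>\<^sub>0 where "\<kappa>\<^sub>0 = k * (T + g) / (2 * T)"
  define \<kappa>\<^sub>1 where "\<kappa>\<^sub>1 = \<kappa>\<^sub>0 + p * v"
  define A0 where "A0 = k\<^sup>2 * ((T + g)\<^sup>2 + T * \<tau>\<^sup>2) / (4 * T)"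
  have \<kappa>: "\<kappa> = (1 - \<theta>) * \<kappa>\<^sub>0 + \<theta> * \<kappa>\<^sub>1"
  proof -
    have "2 * T * \<kappa> = 2 * T * k + T * (2 * w3)" by (simp add: k_def field_simps)
    also have "\<dots> = 2 * T * k + T * (2 * p * w1 - k * (T - g))" by (simp only: w3)
    also have "\<dots> = k * (T + g) + 2 * T * p * \<omega> + (2 * T * (p * k * \<alpha>) + k * T * 1 - k * T * T + k * T * g - k * g)"
      by (simp add: \<omega>_def field_simps)
    also have "2 * T * (p * k * \<alpha>) = p * k * (p * (T - g))" by (simp flip: \<alpha>T)
    also have "k * (T + g) + 2 * T * p * \<omega> + (p * k * (p * (T - g)) + k * T * 1 - k * T * T + k * T * g - k * g)
        = k * (T + g) + 2 * T * p * \<omega>"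
      by (simp add: T_def field_simps power2_eq_square)
    also have "\<dots> = 2 * T * (\<kappa>\<^sub>0 + p * \<omega>)" using T by (simp add: \<kappa>\<^sub>0_def field_simps)
    finally have "\<kappa> = \<kappa>\<^sub>0 + p * \<omega>" using T by simp
    then show ?thesis by (simp add: \<theta>(1) \<kappa>\<^sub>1_def field_simps)
  qed
  have W: "w1\<^sup>2 + w2\<^sup>2 + w3\<^sup>2 = A0 + T * \<omega>\<^sup>2"
  proof -
    have "w3 = p * \<omega> - k * (T - g) / (2 * T)"
    proof -
      have "2 * T * w3 = T * (2 * p * w1 - k * (T - g))" by (simp flip: w3)
      also have "\<dots> = 2 * T * p * \<omega> + p * k * (2 * T * \<alpha>) - k * (T - g) * T"
        by (simp add: \<omega>_def field_simps)
      also have "\<dots> = 2 * T * p * \<omega> - k * (T - g)" unfolding \<alpha>T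
        by (simp add: T_def field_simps power2_eq_square)
      finally show ?thesis using T by (simp add: field_simps)
    qed
    moreover have "w1 = \<omega> + p * (k * (T - g) / (2 * T))" by (simp add: \<omega>_def \<alpha>_def)
    moreover have "(x + p * y)\<^sup>2 + (p * x - y)\<^sup>2 = (1 + p\<^sup>2) * (x\<^sup>2 + y\<^sup>2)" for x y
      by (simp add: algebra_simps power2_eq_square)
    ultimately have "w1\<^sup>2 + w3\<^sup>2 = T * \<omega>\<^sup>2 + T * (k * (T - g) / (2 * T))\<^sup>2"
      by (simp only: T_def ring_distribs)
    also have "T * (k * (T - g) / (2 * T))\<^sup>2 = k\<^sup>2 * (T - g)\<^sup>2 / (4 * T)"
      using T by (simp add: power2_eq_square field_simps)
    finally have "w1\<^sup>2 + w2\<^sup>2 + w3\<^sup>2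
        = T * \<omega>\<^sup>2 + (k\<^sup>2 * (T - g)\<^sup>2 / (4 * T) + k\<^sup>2 * (q + \<tau> / 2)\<^sup>2)"
      by (simp add: w2 power_mult_distrib)
    also have "k\<^sup>2 * X / (4 * T) + k\<^sup>2 * Y = k\<^sup>2 * (X + 4 * T * Y) / (4 * T)" for X Y
      using T by (simp add: field_simps)
    also have "(T - g)\<^sup>2 + 4 * T * (q + \<tau> / 2)\<^sup>2 = (T + g)\<^sup>2 + T * \<tau>\<^sup>2"
      by (simp add: g_def field_simps power2_eq_square)
    finally show ?thesis by (simp add: A0_def)
  qed
  \<comment> \<open>Because \<open>T \<ge> 1\<close>, this gives \<open>T + g \<ge> 15 / 16 * T\<close>, which with \<open>4 - T \<ge> 3 / 4\<close> settles the first ray.\<close>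
  have g16: "T - 1 / 16 \<le> T + g"
  proof -
    have "g = (q + \<tau> / 2)\<^sup>2 - \<tau>\<^sup>2 / 4" by (simp add: g_def field_simps power2_eq_square)
    then show ?thesis using size(2) zero_le_power2[of "q + \<tau> / 2"] by linarith
  qed
  then have gpos: "0 < T + g" using T by linarith
  have k0: "0 \<le> \<kappa>\<^sub>0" using kpos gpos T by (simp add: \<kappa>\<^sub>0_def)
  have A0le: "A0 \<le> (2 * \<kappa>\<^sub>0)\<^sup>2"
  proof -
    have "(15 / 16 * T)\<^sup>2 \<le> (T + g)\<^sup>2" using g16 T by (intro power_mono) auto
    then have "225 / 256 * T\<^sup>2 \<le> (T + g)\<^sup>2" by (simp add: power_mult_distrib power2_eq_square)
    then have *: "3 / 4 * (225 / 256 * T\<^sup>2) \<le> (4 - T) * (T + g)\<^sup>2"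
      using T by (intro mult_mono) auto
    have "T\<^sup>2 * \<tau>\<^sup>2 \<le> T\<^sup>2 * (1 / 4)" using size(2) by (intro mult_left_mono) auto
    then have "T * ((T + g)\<^sup>2 + T * \<tau>\<^sup>2) \<le> 4 * (T + g)\<^sup>2"
    proof -
      have "T * (X + T * \<tau>\<^sup>2) = 4 * X - (4 - T) * X + T\<^sup>2 * \<tau>\<^sup>2" for X
        by (simp add: algebra_simps power2_eq_square)
      moreover have "0 \<le> T\<^sup>2" by simp
      with * \<open>T\<^sup>2 * \<tau>\<^sup>2 \<le> T\<^sup>2 * (1 / 4)\<close> have "T\<^sup>2 * \<tau>\<^sup>2 \<le> (4 - T) * (T + g)\<^sup>2"
        by linarith
      ultimately show ?thesis by simp
    qed
    then have "k\<^sup>2 / (4 * T\<^sup>2) * (T * ((T + g)\<^sup>2 + T * \<tau>\<^sup>2)) \<le> k\<^sup>2 / (4 * T\<^sup>2) * (4 * (T + g)\<^sup>2)"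
      by (intro mult_left_mono) auto
    moreover have "k\<^sup>2 / (4 * T\<^sup>2) * (T * ((T + g)\<^sup>2 + T * \<tau>\<^sup>2)) = A0"
      using T by (simp add: A0_def power2_eq_square field_simps)
    moreover have "k\<^sup>2 / (4 * T\<^sup>2) * (4 * (T + g)\<^sup>2) = (2 * \<kappa>\<^sub>0)\<^sup>2"
      using T by (simp add: \<kappa>\<^sub>0_def power2_eq_square field_simps)
    ultimately show ?thesis by simp
  qed
  \<comment> \<open>The plane of the four vertices is \<open>X \<bullet> V = L\<close> for a normal \<open>V\<close> with \<open>(norm V)\<^sup>2 = L\<^sup>2 + 2 * \<tau>\<^sup>2\<close>.\<close>
  define L where "L = 1 - \<tau>\<^sup>2 / 2 + (p + \<sigma> / 2)\<^sup>2 + (q + \<tau> / 2)\<^sup>2"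
  have L: "7 / 8 \<le> L" using size(2) zero_le_power2[of "p + \<sigma> / 2"] zero_le_power2[of "q + \<tau> / 2"]
    unfolding L_def by linarith
  have \<kappa>1: "\<kappa>\<^sub>1 = k * L / 2"
  proof -
    have "2 * T * \<kappa>\<^sub>1 = k * (T + g) + p * k * (2 * T * (p + \<sigma> / 2) - 2 * T * \<alpha>)"
      using T by (simp add: \<kappa>\<^sub>1_def \<kappa>\<^sub>0_def v_def field_simps)
    also have "\<dots> = k * ((T + g) + p * (2 * T * (p + \<sigma> / 2) - p * (T - g)))"
      unfolding \<alpha>T by (simp add: field_simps)
    also have "(T + g) + p * (2 * T * (p + \<sigma> / 2) - p * (T - g)) = T * (1 + g + p\<^sup>2 + p * \<sigma>)"
      by (simp add: T_def field_simps power2_eq_square)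
    also have "1 + g + p\<^sup>2 + p * \<sigma> = L"
      using size(1) by (simp add: L_def g_def field_simps power2_eq_square)
    finally have "2 * T * \<kappa>\<^sub>1 = 2 * T * (k * L / 2)" by (simp add: field_simps)
    then show ?thesis using T by (subst (asm) mult_cancel_left) auto
  qed
  have k1: "0 \<le> \<kappa>\<^sub>1" using kpos L by (simp add: \<kappa>1)
  have V: "A0 + T * v\<^sup>2 = k\<^sup>2 * (L\<^sup>2 + 2 * \<tau>\<^sup>2) / 4"
  proof -
    have "4 * T * (A0 + T * v\<^sup>2) = k\<^sup>2 * ((T + g)\<^sup>2 + T * \<tau>\<^sup>2 + (2 * T * (p + \<sigma> / 2) - 2 * T * \<alpha>)\<^sup>2)"
      using T by (simp add: A0_def v_def power_mult_distrib field_simps power2_eq_square)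
    also have "(T + g)\<^sup>2 + T * \<tau>\<^sup>2 + (2 * T * (p + \<sigma> / 2) - 2 * T * \<alpha>)\<^sup>2
        = T * ((1 + g + p\<^sup>2 + p * \<sigma>)\<^sup>2 + \<tau>\<^sup>2 + \<sigma>\<^sup>2)"
      unfolding \<alpha>T by (simp add: T_def field_simps power2_eq_square)
    also have "1 + g + p\<^sup>2 + p * \<sigma> = L"
      using size(1) by (simp add: L_def g_def field_simps power2_eq_square)
    finally have "4 * T * (A0 + T * v\<^sup>2) = 4 * T * (k\<^sup>2 * (L\<^sup>2 + 2 * \<tau>\<^sup>2) / 4)"
      using size(1) by (simp add: field_simps)
    then show ?thesis using T by (subst (asm) mult_cancel_left) auto
  qed
  have A1le: "A0 + T * v\<^sup>2 \<le> (2 * \<kappa>\<^sub>1)\<^sup>2"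
  proof -
    have "(7 / 8)\<^sup>2 \<le> L\<^sup>2" using L by (intro power_mono) auto
    then have "L\<^sup>2 + 2 * \<tau>\<^sup>2 \<le> 4 * L\<^sup>2" using size(2) by (simp add: power2_eq_square)
    then have "k\<^sup>2 * (L\<^sup>2 + 2 * \<tau>\<^sup>2) / 4 \<le> k\<^sup>2 * (4 * L\<^sup>2) / 4"
      by (intro divide_right_mono mult_left_mono) auto
    then show ?thesis by (simp add: V \<kappa>1 power_mult_distrib)
  qed
  have A01: "A0 \<le> 4 * \<kappa>\<^sub>0 * \<kappa>\<^sub>1"
  proof -
    have A0n: "0 \<le> A0" using T by (simp add: A0_def)
    have "sqrt A0 \<le> 2 * \<kappa>\<^sub>0" using A0le k0 by (simp add: real_le_lsqrt)
    moreover have "A0 \<le> (2 * \<kappa>\<^sub>1)\<^sup>2" using A1le T by (smt (verit) mult_nonneg_nonneg zero_le_power2)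
    then have "sqrt A0 \<le> 2 * \<kappa>\<^sub>1" using k1 by (simp add: real_le_lsqrt)
    ultimately have "sqrt A0 * sqrt A0 \<le> 2 * \<kappa>\<^sub>0 * (2 * \<kappa>\<^sub>1)"
      using A0n k0 by (intro mult_mono) auto
    then show ?thesis using A0n by simp
  qed
  have "A0 + T * \<omega>\<^sup>2 = (1 - \<theta>)\<^sup>2 * A0 + 2 * \<theta> * (1 - \<theta>) * A0 + \<theta>\<^sup>2 * (A0 + T * v\<^sup>2)"
    by (simp add: \<theta>(1) field_simps power2_eq_square)
  also have "\<dots> \<le> (1 - \<theta>)\<^sup>2 * (2 * \<kappa>\<^sub>0)\<^sup>2 + 2 * \<theta> * (1 - \<theta>) * (4 * \<kappa>\<^sub>0 * \<kappa>\<^sub>1) + \<theta>\<^sup>2 * (2 * \<kappa>\<^sub>1)\<^sup>2"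
    using A0le A1le A01 \<theta> by (intro add_mono mult_left_mono) auto
  also have "\<dots> = 4 * \<kappa>\<^sup>2"
    by (simp add: \<kappa> field_simps power2_eq_square)
  finally have "w1\<^sup>2 + w2\<^sup>2 + w3\<^sup>2 \<le> 4 * \<kappa>\<^sup>2" by (simp add: W)
  moreover have "0 \<le> \<kappa>" using \<kappa> \<theta> k0 k1 by simp
  ultimately show ?thesis by simp
qed

section \<open>Distance to an edge of the vertex hull\<close>

text \<open>The hull touches the hyperplane through its point \<open>p\<close> nearest to \<open>y\<close> in a face, and a face of
  the hull of a finite set is spanned by the members of the set that it contains. This reduces
  the question in which face \<open>p\<close> lies to the vanishing of finitely many inner products.\<close>
lemma closest_point_hull_face:
  fixes S :: "'a::euclidean_space set"
  assumes "finite S" "S \<noteq> {}"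
  obtains p where "p \<in> convex hull S" "\<And>X. X \<in> S \<Longrightarrow> (y - p) \<bullet> (X - p) \<le> 0"
    "p \<in> convex hull {X \<in> S. (y - p) \<bullet> (X - p) = 0}"
proof -
  define K where "K = convex hull S"
  define p where "p = closest_point K y"
  have K: "convex K" "closed K" "K \<noteq> {}" "S \<subseteq> K"
    using assms by (auto simp: K_def hull_inc finite_imp_compact_convex_hull compact_imp_closed)
  have p: "p \<in> K" unfolding p_def by (intro closest_point_in_set K)
  have le: "(y - p) \<bullet> (X - p) \<le> 0" if "X \<in> K" for X
    unfolding p_def using K that by (intro closest_point_dot)
  have "K \<inter> {X. (y - p) \<bullet> X = (y - p) \<bullet> p} face_of K"
    using le K by (intro face_of_Int_supporting_hyperplane_le) (auto simp: inner_diff_right)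
  then obtain S' where S': "S' \<subseteq> S" "K \<inter> {X. (y - p) \<bullet> X = (y - p) \<bullet> p} = convex hull S'"
    unfolding K_def using assms face_of_convex_hull_subset[of S] finite_imp_compact by metis
  have "S' \<subseteq> {X \<in> S. (y - p) \<bullet> (X - p) = 0}"
    using S' hull_subset[of S' convex] by (auto simp: inner_diff_right)
  moreover have "p \<in> convex hull S'" using S' p by auto
  ultimately have "p \<in> convex hull {X \<in> S. (y - p) \<bullet> (X - p) = 0}"
    using hull_mono by blast
  then show ?thesis using that p le K by (auto simp: K_def)
qed

text \<open>At the two ends of the edge, \<open>corner_acute\<close> contradicts the inequalities for the vertices.
  At any other point \<open>p\<close> of the edge, the two inequalities for its ends must be equalities, so
  the difference is perpendicular to the edge and \<open>edge_cone\<close> applies. By the power of the point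
  \<open>p\<close>, the squared norm of \<open>p\<close> is at least \<open>1\<close> minus a quarter of the squared edge.\<close>
lemma edge_approx:
  fixes z q q1 q2 q3 :: "real^2" and p :: "real^3"
  assumes q: "q$1 = a" "q$2 = b" "q1$1 = a + \<sigma>" "q1$2 = b"
      "q2$1 = a" "q2$2 = b + \<tau>" "q3$1 = a + \<sigma>" "q3$2 = b + \<tau>"
    and z: "z$1 = a + l * \<sigma>" "z$2 = b + \<mu> * \<tau>" "0 \<le> l" "l \<le> 1" "0 \<le> \<mu>" "\<mu> \<le> 1"
    and size: "\<sigma>\<^sup>2 = \<tau>\<^sup>2" "\<tau>\<^sup>2 \<le> 1 / 4" "\<sigma> \<noteq> 0" "\<bar>a\<bar> \<le> 3 / 2"
    and p: "p \<in> convex hull {inv_stereo q, inv_stereo q2}"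
    and le: "\<And>y. y \<in> {q, q1, q2, q3} \<Longrightarrow> (inv_stereo z - p) \<bullet> (inv_stereo y - p) \<le> 0"
  shows "norm (inv_stereo z - p) \<le> (dist (inv_stereo q) (inv_stereo q2))\<^sup>2 / 4"
proof (cases "inv_stereo z = p")
  case False
  define w where "w = inv_stereo z - p"
  define \<kappa> where "\<kappa> = w \<bullet> p"
  obtain \<theta> where \<theta>: "p = (1 - \<theta>) *\<^sub>R inv_stereo q + \<theta> *\<^sub>R inv_stereo q2" "0 \<le> \<theta>" "\<theta> \<le> 1"
    using p by (auto simp: segment_convex_hull[symmetric] in_segment)
  have le': "w \<bullet> inv_stereo y \<le> \<kappa>" if "y \<in> {q, q1, q2, q3}" for y
    using le[OF that] by (simp add: w_def \<kappa>_def inner_diff_right)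
  have "\<theta> \<noteq> 0"
  proof
    assume "\<theta> = 0"
    then have "p = inv_stereo q" using \<theta> by simp
    then show False
      using corner_acute[OF q(1-6) z(1,2) size(1,2) z(3-6)] le[of q1] le[of q2] False by fastforce
  qed
  have "\<theta> \<noteq> 1"
  proof
    assume "\<theta> = 1"
    then have "p = inv_stereo q2" using \<theta> by simp
    then show False
      using corner_acute[of q2 a "b + \<tau>" q3 \<sigma> q "- \<tau>" z l "1 - \<mu>"] le[of q3] le[of q] False q z size
      by (fastforce simp: algebra_simps)
  qed
  have "(1 - \<theta>) * (\<kappa> - w \<bullet> inv_stereo q) + \<theta> * (\<kappa> - w \<bullet> inv_stereo q2) = 0"
  proof -
    have "\<kappa> = (1 - \<theta>) * (w \<bullet> inv_stereo q) + \<theta> * (w \<bullet> inv_stereo q2)"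
      unfolding \<kappa>_def by (subst \<theta>(1)) (simp add: inner_add_right)
    then show ?thesis by (simp add: algebra_simps)
  qed
  moreover have "0 \<le> (1 - \<theta>) * (\<kappa> - w \<bullet> inv_stereo q)" "0 \<le> \<theta> * (\<kappa> - w \<bullet> inv_stereo q2)"
    using le' \<theta> by auto
  ultimately have "(1 - \<theta>) * (\<kappa> - w \<bullet> inv_stereo q) = 0" "\<theta> * (\<kappa> - w \<bullet> inv_stereo q2) = 0"
    by linarith+
  then have eq: "w \<bullet> inv_stereo q = \<kappa>" "w \<bullet> inv_stereo q2 = \<kappa>"
    using \<open>\<theta> \<noteq> 0\<close> \<open>\<theta> \<noteq> 1\<close> by auto
  have \<Lambda>: "2 * y$1 * w$1 + 2 * y$2 * w$2 + ((y$1)\<^sup>2 + (y$2)\<^sup>2 - 1) * w$3 - (1 + (y$1)\<^sup>2 + (y$2)\<^sup>2) * \<kappa>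
      = denom y * (w \<bullet> inv_stereo y - \<kappa>)" for y
    unfolding right_diff_distrib denom_inner_inv_stereo by (simp add: denom_def)
  \<comment> \<open>The line with first coordinate \<open>a\<close> is mapped into the plane \<open>X$1 + a * X$3 = a\<close> through the
    north pole.\<close>
  have on_line: "inv_stereo y$1 + a * inv_stereo y$3 = a + 2 * (y$1 - a) / denom y" for y
    by (simp add: inv_stereo_nth field_simps diff_divide_distrib)
  have "p$1 + a * p$3 = (1 - \<theta>) * (inv_stereo q$1 + a * inv_stereo q$3)
      + \<theta> * (inv_stereo q2$1 + a * inv_stereo q2$3)"
    by (simp add: \<theta>(1) algebra_simps)
  then have "p$1 + a * p$3 = a" by (simp add: on_line q algebra_simps)
  then have "w$1 + a * w$3 = 2 * (z$1 - a) / denom z"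
    using on_line[of z] by (simp add: w_def algebra_simps)
  then have "\<sigma> * (w$1 + a * w$3) = 2 * l * \<sigma>\<^sup>2 / denom z"
    by (simp add: z power2_eq_square)
  then have side: "0 \<le> \<sigma> * (w$1 + a * w$3)"
    using denom_pos[of z] z by simp
  have "w \<bullet> inv_stereo z - \<kappa> = (norm w)\<^sup>2"
    by (simp add: \<kappa>_def w_def power2_norm_eq_inner inner_diff_right)
  then have pos: "0 < denom z * (w \<bullet> inv_stereo z - \<kappa>)"
    using False denom_pos by (simp add: w_def)
  have "0 \<le> \<kappa> \<and> (w$1)\<^sup>2 + (w$2)\<^sup>2 + (w$3)\<^sup>2 \<le> 4 * \<kappa>\<^sup>2"
    using \<Lambda>[of q] \<Lambda>[of q2] \<Lambda>[of q1] \<Lambda>[of z] eq le'[of q1] pos denom_pos[of q1]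
    by (intro edge_cone[OF size _ _ _ z(3-6) _ side, of b])
      (simp_all add: q z mult_nonneg_nonpos)
  moreover have "(norm w)\<^sup>2 = (w$1)\<^sup>2 + (w$2)\<^sup>2 + (w$3)\<^sup>2"
    by (simp only: power2_norm_eq_inner inner_vec3) (simp add: power2_eq_square)
  ultimately have "0 \<le> \<kappa>" "(norm w)\<^sup>2 \<le> (2 * \<kappa>)\<^sup>2" by simp_all
  then have "norm w \<le> 2 * \<kappa>" using power2_le_imp_le[of "norm w" "2 * \<kappa>"] by simp
  moreover have "(norm p)\<^sup>2 + 2 * \<kappa> + (norm w)\<^sup>2 = 1"
  proof -
    have "(norm (p + w))\<^sup>2 = 1" by (simp add: w_def)
    then show ?thesis by (simp add: power2_norm_eq_inner inner_add \<kappa>_def inner_commute)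
  qed
  moreover have "1 - (dist (inv_stereo q) (inv_stereo q2))\<^sup>2 / 4 \<le> (norm p)\<^sup>2"
  proof -
    define e where "e = (dist (inv_stereo q) (inv_stereo q2))\<^sup>2"
    have ip: "inv_stereo q \<bullet> inv_stereo q2 = 1 - e / 2"
      using dist_inv_stereo[of q q2] inner_inv_stereo[of q q2] by (simp add: e_def)
    have "(norm p)\<^sup>2 = (1 - \<theta>)\<^sup>2 * (inv_stereo q \<bullet> inv_stereo q)
        + 2 * \<theta> * (1 - \<theta>) * (inv_stereo q \<bullet> inv_stereo q2)
        + \<theta>\<^sup>2 * (inv_stereo q2 \<bullet> inv_stereo q2)"
      unfolding power2_norm_eq_inner
      by (subst (1 2) \<theta>(1)) (simp add: inner_add inner_commute algebra_simps power2_eq_square)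
    also have "\<dots> = 1 - \<theta> * (1 - \<theta>) * e"
      by (simp add: ip inner_inv_stereo[of x x for x] algebra_simps power2_eq_square)
    finally have "(norm p)\<^sup>2 = 1 - \<theta> * (1 - \<theta>) * e" .
    moreover have "1 - \<theta> * (1 - \<theta>) * e \<ge> 1 - 1 / 4 * e"
    proof -
      have "0 \<le> (\<theta> - 1 / 2)\<^sup>2" by simp
      then have "\<theta> * (1 - \<theta>) \<le> 1 / 4" by (simp add: power2_eq_square algebra_simps)
      then have "\<theta> * (1 - \<theta>) * e \<le> 1 / 4 * e"
        by (intro mult_right_mono) (simp_all add: e_def)
      then show ?thesis by simp
    qed
    ultimately show ?thesis by (simp add: e_def)
  qed
  moreover have "0 \<le> (norm w)\<^sup>2" by simp
  ultimately have "norm w \<le> (dist (inv_stereo q) (inv_stereo q2))\<^sup>2 / 4" by linarith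
  then show ?thesis by (simp add: w_def)
qed simp

text \<open>Reflection in the diagonal of the plane carries the horizontal sides of a square to vertical
  ones, and the projection intertwines it with an isometry of space.\<close>
definition swap2 :: "real^2 \<Rightarrow> real^2" where "swap2 z = vector [z$2, z$1]"
definition swap3 :: "real^3 \<Rightarrow> real^3" where "swap3 X = vector [X$2, X$1, X$3]"

lemma swap3_nth [simp]: "swap3 X $ 1 = X $ 2" "swap3 X $ 2 = X $ 1" "swap3 X $ 3 = X $ 3"
  by (simp_all add: swap3_def)
lemma swap2_nth [simp]: "swap2 X $ 1 = X $ 2" "swap2 X $ 2 = X $ 1"
  by (simp_all add: swap2_def)

lemma inv_stereo_swap2: "inv_stereo (swap2 z) = swap3 (inv_stereo z)"
  by (simp add: vec_eq_iff forall_3 inv_stereo_nth denom_def add.commute add.left_commute)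

lemma linear_swap3: "linear swap3"
  by (rule linearI) (simp_all add: vec_eq_iff forall_3)

lemma inner_swap3 [simp]: "swap3 X \<bullet> swap3 Y = X \<bullet> Y"
  by (simp add: inner_vec3)

lemma norm_swap3 [simp]: "norm (swap3 X) = norm X"
  by (simp add: norm_eq_sqrt_inner)

lemma edge_approx_swap:
  fixes z q q1 q2 q3 :: "real^2" and p :: "real^3"
  assumes q: "q$2 = a" "q$1 = b" "q1$2 = a + \<sigma>" "q1$1 = b"
      "q2$2 = a" "q2$1 = b + \<tau>" "q3$2 = a + \<sigma>" "q3$1 = b + \<tau>"
    and z: "z$2 = a + l * \<sigma>" "z$1 = b + \<mu> * \<tau>" "0 \<le> l" "l \<le> 1" "0 \<le> \<mu>" "\<mu> \<le> 1"
    and size: "\<sigma>\<^sup>2 = \<tau>\<^sup>2" "\<tau>\<^sup>2 \<le> 1 / 4" "\<sigma> \<noteq> 0" "\<bar>a\<bar> \<le> 3 / 2"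
    and p: "p \<in> convex hull {inv_stereo q, inv_stereo q2}"
    and le: "\<And>y. y \<in> {q, q1, q2, q3} \<Longrightarrow> (inv_stereo z - p) \<bullet> (inv_stereo y - p) \<le> 0"
  shows "norm (inv_stereo z - p) \<le> (dist (inv_stereo q) (inv_stereo q2))\<^sup>2 / 4"
proof -
  have "swap3 p \<in> swap3 ` (convex hull {inv_stereo q, inv_stereo q2})" using p by blast
  also have "\<dots> = convex hull {inv_stereo (swap2 q), inv_stereo (swap2 q2)}"
    by (simp add: convex_hull_linear_image[OF linear_swap3] inv_stereo_swap2)
  finally have p': "swap3 p \<in> \<dots>" .
  have "norm (inv_stereo (swap2 z) - swap3 p)
      \<le> (dist (inv_stereo (swap2 q)) (inv_stereo (swap2 q2)))\<^sup>2 / 4"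
  proof (rule edge_approx[where q = "swap2 q" and ?q1.0 = "swap2 q1" and ?q2.0 = "swap2 q2"
        and ?q3.0 = "swap2 q3" and a = a and b = b, OF _ _ _ _ _ _ _ _ _ _ z(3-6) size p'])
    fix y assume "y \<in> {swap2 q, swap2 q1, swap2 q2, swap2 q3}"
    then obtain y' where "y' \<in> {q, q1, q2, q3}" "y = swap2 y'" by blast
    then show "(inv_stereo (swap2 z) - swap3 p) \<bullet> (inv_stereo y - swap3 p) \<le> 0"
      using le by (simp only: inv_stereo_swap2 linear_diff[OF linear_swap3, symmetric] inner_swap3)
  qed (simp_all add: q z)
  then show ?thesis
    by (simp add: inv_stereo_swap2 linear_diff[OF linear_swap3, symmetric] dist_norm)
qed

section \<open>Distance to the plane of the vertices\<close>

lemma denom_alt: "denom z = 1 + (norm z)\<^sup>2"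
  by (simp only: power2_norm_eq_inner inner_vec2) (simp add: denom_def power2_eq_square)

lemma bounded_inv_stereo: "bounded (inv_stereo ` S)"
  unfolding bounded_iff by (intro exI[of _ 1]) auto

lemma dist_le_disk_diam:
  assumes "vertex_disk Q = cball c r" "y \<in> cball c r" "z \<in> cball c r"
  shows "dist (inv_stereo y) (inv_stereo z) \<le> disk_diam Q"
  unfolding disk_diam_def assms(1)
  by (intro diameter_bounded_bound bounded_inv_stereo imageI assms)

text \<open>The disk \<open>cball c r\<close> is mapped to the cap \<open>{X. X \<bullet> V \<ge> L}\<close> of the sphere for a vector \<open>V\<close>
  with \<open>(norm V)\<^sup>2 = L\<^sup>2 + 4 * r\<^sup>2\<close>; the left-hand side is the squared diameter of its boundary
  circle. It is attained at the ends of the diameter of the disk on the line through the origin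
  and \<open>c\<close>.\<close>
lemma disk_diam_ge:
  assumes "vertex_disk Q = cball c r" "0 \<le> r"
  defines "L \<equiv> 1 - r\<^sup>2 + (norm c)\<^sup>2"
  shows "4 * (1 - L\<^sup>2 / (L\<^sup>2 + 4 * r\<^sup>2)) \<le> (disk_diam Q)\<^sup>2"
proof -
  obtain e :: "real^2" where e: "norm e = 1" "c = norm c *\<^sub>R e"
  proof (cases "c = 0")
    case True
    then show ?thesis using that[of "axis 1 1"] by simp
  next
    case False
    then show ?thesis using that[of "c /\<^sub>R norm c"] by simp
  qed
  define y where "y = c + r *\<^sub>R e"
  define z where "z = c - r *\<^sub>R e"
  have y: "y = (norm c + r) *\<^sub>R e" and z: "z = (norm c - r) *\<^sub>R e"
    unfolding y_def z_def by (subst e(2), simp add: algebra_simps)+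
  have "y \<in> cball c r" "z \<in> cball c r"
    using e(1) assms(2) by (simp_all add: y_def z_def dist_norm)
  then have "(dist (inv_stereo y) (inv_stereo z))\<^sup>2 \<le> (disk_diam Q)\<^sup>2"
    by (intro power_mono dist_le_disk_diam[OF assms(1)]) auto
  moreover have "denom y * denom z = L\<^sup>2 + 4 * r\<^sup>2"
    by (simp add: denom_alt y z e(1) L_def) (simp add: algebra_simps power2_eq_square)
  moreover have "(dist y z)\<^sup>2 = 4 * r\<^sup>2"
  proof -
    have "y - z = (2 * r) *\<^sub>R e" unfolding y_def z_def by (simp add: scaleR_2 [symmetric] algebra_simps)
    then show ?thesis by (simp add: dist_norm e(1) power_mult_distrib)
  qed
  moreover have "0 < denom y * denom z" using denom_pos by simp
  ultimately show ?thesis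
    by (simp add: dist_inv_stereo field_simps)
qed

text \<open>The functional \<open>m\<close> attains its maximum \<open>b\<close> over the hull exactly on the segment of the two
  given images, so this segment is an edge.\<close>
lemma dist_le_hull_edge:
  assumes "finite Q" "q \<in> Q" "q' \<in> Q" "q \<noteq> q'" "m \<bullet> inv_stereo q = b" "m \<bullet> inv_stereo q' = b"
    and less: "\<And>y. y \<in> Q \<Longrightarrow> y \<noteq> q \<Longrightarrow> y \<noteq> q' \<Longrightarrow> m \<bullet> inv_stereo y < b"
  shows "dist (inv_stereo q) (inv_stereo q') \<le> hull_edge Q"
proof -
  define K where "K = convex hull (inv_stereo ` Q)"
  define e where "e = convex hull {inv_stereo q, inv_stereo q'}"
  have le: "m \<bullet> X \<le> b" if "X \<in> K" for X
  proof -
    have "K \<subseteq> {X. m \<bullet> X \<le> b}"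
      unfolding K_def using less assms by (intro hull_minimal convex_halfspace_le) force
    then show ?thesis using that by blast
  qed
  then have "K \<inter> {X. m \<bullet> X = b} face_of K"
    by (intro face_of_Int_supporting_hyperplane_le) (auto simp: K_def)
  moreover have "K \<inter> {X. m \<bullet> X = b} = e"
  proof -
    obtain S' where S': "S' \<subseteq> inv_stereo ` Q" "K \<inter> {X. m \<bullet> X = b} = convex hull S'"
      using face_of_convex_hull_subset[of "inv_stereo ` Q" "K \<inter> {X. m \<bullet> X = b}"] calculation assms(1)
      unfolding K_def by (metis finite_imageI finite_imp_compact)
    have "S' \<subseteq> {inv_stereo q, inv_stereo q'}"
    proof
      fix X assume X: "X \<in> S'"
      then obtain y where y: "y \<in> Q" "X = inv_stereo y" using S' by blast
      have "m \<bullet> X = b" using X S' hull_inc[of X S'] by blast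
      then show "X \<in> {inv_stereo q, inv_stereo q'}" using less[OF y(1)] y(2) by force
    qed
    then have "K \<inter> {X. m \<bullet> X = b} \<subseteq> e" unfolding S'(2) e_def by (rule hull_mono)
    moreover have "e \<subseteq> K \<inter> {X. m \<bullet> X = b}"
    proof -
      have "e \<subseteq> K" unfolding e_def K_def using assms by (intro hull_mono) auto
      moreover have "e \<subseteq> {X. m \<bullet> X = b}"
        unfolding e_def using assms by (intro hull_minimal convex_hyperplane) auto
      ultimately show ?thesis by blast
    qed
    ultimately show ?thesis by blast
  qed
  ultimately have "e face_of K" by simp
  moreover have "inv_stereo q \<noteq> inv_stereo q'" using assms(4) inj_inv_stereo by (auto dest: injD)
  then have "aff_dim e = 1" unfolding e_def by (simp add: aff_dim_convex_hull aff_dim_2)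
  ultimately have edge: "e edge_of K" by (simp add: edge_of_def)
  have "finite {e. e edge_of K}"
    using finite_polytope_faces[of K] assms(1) finite_subset[of "{e. e edge_of K}" "{F. F face_of K}"]
    by (auto simp: edge_of_def K_def polytope_convex_hull)
  then have "diameter e \<le> hull_edge Q"
    unfolding hull_edge_def K_def[symmetric] using edge by (intro Max_ge) auto
  moreover have "dist (inv_stereo q) (inv_stereo q') \<le> diameter e"
    unfolding e_def by (intro diameter_bounded_bound bounded_convex_hull) (auto intro: hull_inc)
  ultimately show ?thesis by simp
qed

lemma chi_mono: "0 < D \<Longrightarrow> 0 \<le> d \<Longrightarrow> d \<le> d' \<Longrightarrow> chi D d \<le> chi D d'"
  unfolding chi_def by (intro add_mono divide_right_mono power_mono) auto

lemma quarter_less_chi1: "0 < d \<Longrightarrow> d\<^sup>2 / 4 < chi 1 d"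
  by (simp add: chi_def)

text \<open>Here \<open>w\<close> points from \<open>y - w\<close> to \<open>y\<close>, and \<open>\<rho>\<close> is the component of \<open>y - w\<close> in the direction of
  \<open>w\<close>. That of the unit vector \<open>y\<close> itself is at most \<open>1\<close>.\<close>
lemma cap_depth:
  fixes w :: "'a::real_inner"
  assumes "w \<bullet> y = \<rho> * norm w + (norm w)\<^sup>2" "norm y = 1" "w \<noteq> 0"
  shows "norm w \<le> 1 - \<rho>"
proof -
  have "norm w * (\<rho> + norm w) \<le> norm w * 1"
    using norm_cauchy_schwarz[of w y] assms by (simp add: algebra_simps power2_eq_square)
  then show ?thesis using assms(3) by (subst (asm) mult_le_cancel_left_pos) auto
qed

text \<open>As a multiple of the squared norm plus an affine function, the polynomial of
  \<open>w\<close> is determined up to a factor by its zeros at three vertices: it is a multiple of \<open>r\<^sup>2 - (dist c y)\<^sup>2\<close>, and \<open>w\<close> is the corresponding multiple of the normal of the plane that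
  contains the images of the boundary of the disk. The depth of the cap above this plane
  bounds the norm of \<open>w\<close>.\<close>
lemma interior_approx:
  fixes q q1 q2 c z :: "real^2" and p :: "real^3"
  assumes q: "q$1 = c$1 - h" "q$2 = c$2 - h" "q1$1 = c$1 + h" "q1$2 = c$2 - h"
      "q2$1 = c$1 - h" "q2$2 = c$2 + h"
    and h: "0 < h" "h \<le> 1 / 4" and z: "(dist c z)\<^sup>2 \<le> r\<^sup>2" and r: "r\<^sup>2 = 2 * h\<^sup>2" "0 \<le> r"
    and disk: "vertex_disk Q = cball c r"
    and eq: "\<And>y. y \<in> {q, q1, q2} \<Longrightarrow> (inv_stereo z - p) \<bullet> (inv_stereo y - p) = 0"
  shows "norm (inv_stereo z - p) < chi 2 (disk_diam Q)"
proof -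
  define w where "w = inv_stereo z - p"
  define \<kappa> where "\<kappa> = w \<bullet> p"
  define k where "k = \<kappa> - w$3"
  define L where "L = 1 - r\<^sup>2 + (norm c)\<^sup>2"
  define V where "V = sqrt (L\<^sup>2 + 4 * r\<^sup>2)"
  have r8: "0 < r\<^sup>2" "r\<^sup>2 \<le> 1 / 8"
    using h r power_mono[OF h(2), of 2] by (auto simp: power2_eq_square)
  then have L: "0 < L" by (simp add: L_def add_pos_nonneg)
  then have V: "0 < V" "V\<^sup>2 = L\<^sup>2 + 4 * r\<^sup>2" using r8 by (auto simp: V_def add_pos_pos)
  have nc: "(norm c)\<^sup>2 = (c$1)\<^sup>2 + (c$2)\<^sup>2"
    by (simp only: power2_norm_eq_inner inner_vec2) (simp add: power2_eq_square)
  have \<Lambda>: "denom y * (w \<bullet> (inv_stereo y - p))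
      = 2 * y$1 * w$1 + 2 * y$2 * w$2 - k * ((y$1)\<^sup>2 + (y$2)\<^sup>2) - (k + 2 * w$3)" for y
  proof -
    have "denom y * (w \<bullet> (inv_stereo y - p)) = denom y * (w \<bullet> inv_stereo y) - denom y * \<kappa>"
      by (simp add: \<kappa>_def algebra_simps inner_diff_right)
    then show ?thesis
      unfolding denom_inner_inv_stereo by (simp add: denom_def k_def algebra_simps)
  qed
  have \<Lambda>0: "2 * y$1 * w$1 + 2 * y$2 * w$2 - k * ((y$1)\<^sup>2 + (y$2)\<^sup>2) - (k + 2 * w$3) = 0"
    if "y \<in> {q, q1, q2}" for y
    using eq[OF that] unfolding w_def[symmetric] \<Lambda>[symmetric] by simp
  define \<Lambda>' where "\<Lambda>' y = 2 * y$1 * w$1 + 2 * y$2 * w$2 - k * ((y$1)\<^sup>2 + (y$2)\<^sup>2) - (k + 2 * w$3)" for y :: "real^2"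
  have "4 * h * (w$1 - k * c$1) = \<Lambda>' q1 - \<Lambda>' q"
    by (simp add: \<Lambda>'_def q algebra_simps power2_eq_square)
  also have "\<dots> = 0" using \<Lambda>0[of q1] \<Lambda>0[of q] by (simp add: \<Lambda>'_def)
  finally have "4 * h * (w$1 - k * c$1) = 0" .
  then have w1: "w$1 = k * c$1" using h by simp
  have "4 * h * (w$2 - k * c$2) = \<Lambda>' q2 - \<Lambda>' q"
    by (simp add: \<Lambda>'_def q algebra_simps power2_eq_square)
  also have "\<dots> = 0" using \<Lambda>0[of q2] \<Lambda>0[of q] by (simp add: \<Lambda>'_def)
  finally have "4 * h * (w$2 - k * c$2) = 0" .
  then have w2: "w$2 = k * c$2" using h by simp
  have w3: "w$3 = - k * (1 + r\<^sup>2 - (norm c)\<^sup>2) / 2"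
    using \<Lambda>0[of q] unfolding nc r w1 w2 by (simp add: q field_simps power2_eq_square)
  have zz: "denom z * (w \<bullet> (inv_stereo z - p)) = k * (r\<^sup>2 - (dist c z)\<^sup>2)"
    unfolding \<Lambda> w1 w2 w3 nc by (simp add: dist_vec2) (simp add: field_simps power2_eq_square)
  have \<kappa>: "\<kappa> = k * L / 2"
    using w3 by (simp add: k_def L_def field_simps)
  have W: "(norm w)\<^sup>2 = (k * V / 2)\<^sup>2"
  proof -
    have "(norm w)\<^sup>2 = (k / 2)\<^sup>2 * (4 * (c$1)\<^sup>2 + 4 * (c$2)\<^sup>2 + (1 + r\<^sup>2 - (norm c)\<^sup>2)\<^sup>2)"
      by (simp only: power2_norm_eq_inner inner_vec3 w1 w2 w3)
        (simp add: power2_eq_square field_simps)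
    also have "4 * (c$1)\<^sup>2 + 4 * (c$2)\<^sup>2 + (1 + r\<^sup>2 - (norm c)\<^sup>2)\<^sup>2 = L\<^sup>2 + 4 * r\<^sup>2"
      unfolding L_def nc by (simp add: field_simps power2_eq_square)
    finally show ?thesis unfolding V(2)[symmetric] by (simp add: power_mult_distrib power_divide)
  qed
  define \<rho> where "\<rho> = L / V"
  have \<rho>2: "1 - \<rho>\<^sup>2 = 1 - L\<^sup>2 / (L\<^sup>2 + 4 * r\<^sup>2)"
    by (simp add: \<rho>_def power_divide V)
  have "\<rho>\<^sup>2 < 1\<^sup>2"
    using V r8 zero_less_power[OF V(1), of 2] by (simp add: \<rho>_def power_divide divide_less_eq del: zero_less_power2 zero_less_power)
  then have \<rho>: "0 \<le> \<rho>" "\<rho> < 1"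
    using L V power_less_imp_less_base[of \<rho> 2 1] by (auto simp: \<rho>_def)
  have sag: "1 - \<rho> < chi 2 (disk_diam Q)"
    using disk_diam_ge[OF disk r(2)] by (intro chi_sagitta \<rho>) (simp add: \<rho>2 L_def)
  show ?thesis
  proof (cases "w = 0")
    case False
    have wz: "w \<bullet> (inv_stereo z - p) = (norm w)\<^sup>2"
      by (simp add: w_def power2_norm_eq_inner)
    have "0 < k * (r\<^sup>2 - (dist c z)\<^sup>2)"
      unfolding zz[symmetric] wz using False denom_pos by simp
    then have "0 < k" using z by (simp add: zero_less_mult_iff)
    then have nw: "norm w = k * V / 2" using W V by (simp add: power2_eq_iff_nonneg)
    have "w \<bullet> inv_stereo z = \<kappa> + (norm w)\<^sup>2"
      using wz by (simp add: \<kappa>_def inner_diff_right)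
    also have "\<kappa> = \<rho> * norm w" using V by (simp add: nw \<kappa> \<rho>_def)
    finally have "norm w \<le> 1 - \<rho>" using False by (intro cap_depth[of w "inv_stereo z"]) auto
    with sag show ?thesis by (simp add: w_def)
  qed (use sag \<rho> in \<open>simp add: w_def\<close>)
qed

section \<open>Hull approximation for squares\<close>

lemma good_squareE:
  assumes "good_square Q"
  obtains x y s where "Q = square_vertices x y s" "0 < s" "s \<le> 1 / 2"
    "\<bar>x\<bar> \<le> 3 / 2" "\<bar>x + s\<bar> \<le> 3 / 2" "\<bar>y\<bar> \<le> 3 / 2" "\<bar>y + s\<bar> \<le> 3 / 2"
proof -
  from assms obtain x y s where *: "dyadic_box x y s" "Q = square_vertices x y s" "s \<le> 1 / 2"
      "convex hull Q \<subseteq> cbox (vector [-3/2, -3/2]) (vector [3/2, 3/2])"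
    by (auto simp: good_square_def)
  have "vector [x, y] \<in> convex hull Q" "vector [x + s, y + s] \<in> convex hull Q"
    using *(2) by (auto intro!: hull_inc simp: square_vertices_def)
  then have "vector [x, y] \<in> cbox (vector [-3/2, -3/2]) (vector [3/2, 3/2] :: real^2)"
      "vector [x + s, y + s] \<in> cbox (vector [-3/2, -3/2]) (vector [3/2, 3/2] :: real^2)"
    using *(4) by blast+
  then have "\<bar>x\<bar> \<le> 3 / 2" "\<bar>x + s\<bar> \<le> 3 / 2" "\<bar>y\<bar> \<le> 3 / 2" "\<bar>y + s\<bar> \<le> 3 / 2"
    unfolding mem_box_cart forall_2 vector_2 abs_le_iff by linarith+
  then show ?thesis using that[of x y s] * dyadic_box_pos by blast
qed

lemma convex_hull_square_coords:
  assumes "z \<in> convex hull square_vertices x y s" "0 < s"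
  obtains l \<mu> where "0 \<le> l" "l \<le> 1" "0 \<le> \<mu>" "\<mu> \<le> 1" "z$1 = x + l * s" "z$2 = y + \<mu> * s"
proof -
  have "convex hull square_vertices x y s \<subseteq> cbox (vector [x, y]) (vector [x + s, y + s])"
    using assms(2)
    by (intro hull_minimal convex_box) (auto simp: square_vertices_def mem_box_cart forall_2)
  then have "z \<in> cbox (vector [x, y]) (vector [x + s, y + s])" using assms by blast
  then have "x \<le> z$1" "z$1 \<le> x + s" "y \<le> z$2" "z$2 \<le> y + s"
    by (auto simp: mem_box_cart forall_2)
  then show ?thesis
    using assms(2) by (intro that[of "(z$1 - x) / s" "(z$2 - y) / s"]) (auto simp: field_simps)
qed

lemma inner_side_functional:
  "(vector [c, 0, c * a] :: real^3) \<bullet> inv_stereo y = c * a + 2 * (c * (y$1 - a)) / denom y"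
  "(vector [0, c, c * a] :: real^3) \<bullet> inv_stereo y = c * a + 2 * (c * (y$2 - a)) / denom y"
  by (simp_all add: inner_vec3 inv_stereo_nth vector_3 field_simps diff_divide_distrib)

text \<open>The polynomial \<open>denom q * h q\<close> has equal sums over the two diagonals of the square. As it is
  nonpositive at the vertices, vanishing on one diagonal forces vanishing on the other. So the face of
  the nearest point is the whole quadrilateral or is contained in one of its four sides.\<close>
lemma square_hull_approx:
  assumes "good_square Q" "z \<in> convex hull Q"
  shows "\<exists>p \<in> convex hull (inv_stereo ` Q). norm (inv_stereo z - p) < hull_const Q"
proof -
  obtain x y s where Q: "Q = square_vertices x y s" and s: "0 < s" "s \<le> 1 / 2"
      and bnd: "\<bar>x\<bar> \<le> 3 / 2" "\<bar>x + s\<bar> \<le> 3 / 2" "\<bar>y\<bar> \<le> 3 / 2" "\<bar>y + s\<bar> \<le> 3 / 2"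
    using good_squareE[OF assms(1)] .
  obtain l \<mu> where lm: "0 \<le> l" "l \<le> 1" "0 \<le> \<mu>" "\<mu> \<le> 1" and z: "z$1 = x + l * s" "z$2 = y + \<mu> * s"
    using convex_hull_square_coords[of z x y s] assms(2) Q s by metis
  define q00 q10 q01 q11 :: "real^2" where q: "q00 = vector [x, y]" "q10 = vector [x + s, y]"
    "q01 = vector [x, y + s]" "q11 = vector [x + s, y + s]"
  have Qq: "Q = {q00, q10, q01, q11}" by (simp add: Q square_vertices_def q)
  have fin: "finite (inv_stereo ` Q)" "inv_stereo ` Q \<noteq> {}" by (simp_all add: Qq)
  obtain p where p: "p \<in> convex hull (inv_stereo ` Q)"
      and le: "\<And>X. X \<in> inv_stereo ` Q \<Longrightarrow> (inv_stereo z - p) \<bullet> (X - p) \<le> 0"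
      and face: "p \<in> convex hull {X \<in> inv_stereo ` Q. (inv_stereo z - p) \<bullet> (X - p) = 0}"
    using closest_point_hull_face[OF fin, of "inv_stereo z"] by blast
  define h where "h q = (inv_stereo z - p) \<bullet> (inv_stereo q - p)" for q
  define E where "E = {q \<in> Q. h q = 0}"
  have face': "p \<in> convex hull (inv_stereo ` E)"
  proof -
    have "{X \<in> inv_stereo ` Q. (inv_stereo z - p) \<bullet> (X - p) = 0} = inv_stereo ` E"
      by (auto simp: E_def h_def)
    then show ?thesis using face by simp
  qed
  have const: "hull_const Q = max (chi 1 (hull_edge Q)) (chi 2 (disk_diam Q))"
    using segment_not_square assms(1) by (auto simp: hull_const_def)
  have edge: "\<exists>p \<in> convex hull (inv_stereo ` Q). norm (inv_stereo z - p) < hull_const Q"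
    if "norm (inv_stereo z - p) \<le> (dist (inv_stereo q) (inv_stereo q'))\<^sup>2 / 4" "q \<in> Q" "q' \<in> Q" "q \<noteq> q'"
      "m \<bullet> inv_stereo q = b" "m \<bullet> inv_stereo q' = b"
      "\<And>y. y \<in> Q \<Longrightarrow> y \<noteq> q \<Longrightarrow> y \<noteq> q' \<Longrightarrow> m \<bullet> inv_stereo y < b" for q q' m b
  proof -
    have "0 < dist (inv_stereo q) (inv_stereo q')"
      using that(4) inj_inv_stereo by (auto dest: injD)
    then have "norm (inv_stereo z - p) < chi 1 (dist (inv_stereo q) (inv_stereo q'))"
      using that(1) quarter_less_chi1 by (meson order_le_less_trans)
    also have "\<dots> \<le> chi 1 (hull_edge Q)"
      by (rule chi_mono[OF _ _ dist_le_hull_edge[OF _ that(2-7)]]) (simp_all add: Qq)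
    finally have "norm (inv_stereo z - p) < hull_const Q" by (simp add: const)
    with p show ?thesis by blast
  qed
  have edge_v: "\<exists>p \<in> convex hull (inv_stereo ` Q). norm (inv_stereo z - p) < hull_const Q"
    if "norm (inv_stereo z - p) \<le> (dist (inv_stereo q) (inv_stereo q'))\<^sup>2 / 4" "q \<in> Q" "q' \<in> Q" "q \<noteq> q'"
      "q$1 = a" "q'$1 = a" "\<And>y. y \<in> Q \<Longrightarrow> y \<noteq> q \<Longrightarrow> y \<noteq> q' \<Longrightarrow> c * (y$1 - a) < 0" for q q' a c
    by (rule edge[OF that(1-4), where m = "vector [c, 0, c * a]" and b = "c * a"])
      (use that(5-7) in \<open>auto simp: inner_side_functional divide_neg_pos denom_pos\<close>)
  have edge_h: "\<exists>p \<in> convex hull (inv_stereo ` Q). norm (inv_stereo z - p) < hull_const Q"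
    if "norm (inv_stereo z - p) \<le> (dist (inv_stereo q) (inv_stereo q'))\<^sup>2 / 4" "q \<in> Q" "q' \<in> Q" "q \<noteq> q'"
      "q$2 = a" "q'$2 = a" "\<And>y. y \<in> Q \<Longrightarrow> y \<noteq> q \<Longrightarrow> y \<noteq> q' \<Longrightarrow> c * (y$2 - a) < 0" for q q' a c
    by (rule edge[OF that(1-4), where m = "vector [0, c, c * a]" and b = "c * a"])
      (use that(5-7) in \<open>auto simp: inner_side_functional divide_neg_pos denom_pos\<close>)
  have diag: "denom q00 * h q00 + denom q11 * h q11 = denom q10 * h q10 + denom q01 * h q01"
    unfolding h_def inner_diff_right right_diff_distrib denom_inner_inv_stereo
    by (simp add: denom_def q algebra_simps power2_eq_square)
  have le': "h q00 \<le> 0" "h q10 \<le> 0" "h q01 \<le> 0" "h q11 \<le> 0"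
    using le by (auto simp: h_def Qq)
  have ss: "s\<^sup>2 \<le> 1 / 4" using power_mono[OF s(2), of 2] s by (simp add: power2_eq_square)
  have hv: "(inv_stereo z - p) \<bullet> (inv_stereo q00 - p) \<le> 0" "(inv_stereo z - p) \<bullet> (inv_stereo q10 - p) \<le> 0"
      "(inv_stereo z - p) \<bullet> (inv_stereo q01 - p) \<le> 0" "(inv_stereo z - p) \<bullet> (inv_stereo q11 - p) \<le> 0"
    using le' by (simp_all add: h_def)
  have nth: "q00$1 = x" "q00$2 = y" "q10$1 = x + s" "q10$2 = y"
      "q01$1 = x" "q01$2 = y + s" "q11$1 = x + s" "q11$2 = y + s"
    by (simp_all add: q)
  have far: "q00$1 = x + s + - s" "q01$1 = x + s + - s" "q00$2 = y + s + - s" "q10$2 = y + s + - s"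
      "z$1 = x + s + (1 - l) * - s" "z$2 = y + s + (1 - \<mu>) * - s"
    by (simp_all add: q z algebra_simps)
  have flip: "0 \<le> 1 - l" "1 - l \<le> 1" "0 \<le> 1 - \<mu>" "1 - \<mu> \<le> 1" "s \<noteq> 0" "- s \<noteq> 0" "(- s)\<^sup>2 = s\<^sup>2"
    using lm s by simp_all
  consider (all) "h q00 = 0" "h q10 = 0" "h q01 = 0"
    | (left) "E \<subseteq> {q00, q01}" | (right) "E \<subseteq> {q10, q11}"
    | (bottom) "E \<subseteq> {q00, q10}" | (top) "E \<subseteq> {q01, q11}"
  proof -
    have neg: "denom q * h q \<le> 0 \<and> (denom q * h q = 0 \<longleftrightarrow> h q = 0)" if "h q \<le> 0" for q
      using denom_pos[of q] that by (auto simp: mult_le_0_iff)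
    have "h q10 = 0 \<and> h q01 = 0" if "h q00 = 0" "h q11 = 0"
      using diag that neg le' by (smt (verit) mult_zero_right)
    moreover have "h q00 = 0 \<and> h q11 = 0" if "h q10 = 0" "h q01 = 0"
      using diag that neg le' by (smt (verit) mult_zero_right)
    ultimately have "(h q00 = 0 \<and> h q10 = 0 \<and> h q01 = 0)
        \<or> ((h q00 \<noteq> 0 \<or> h q11 \<noteq> 0) \<and> (h q10 \<noteq> 0 \<or> h q01 \<noteq> 0))" by blast
    then show ?thesis using that unfolding E_def Qq by blast
  qed
  then show ?thesis
  proof cases
    case all
    have r: "(s / sqrt 2)\<^sup>2 = 2 * (s / 2)\<^sup>2" by (simp add: power_divide)
    have "norm (inv_stereo z - p) < chi 2 (disk_diam Q)"
    proof (rule interior_approx[where q = q00 and ?q1.0 = q10 and ?q2.0 = q01 and h = "s / 2"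
          and c = "vector [x + s / 2, y + s / 2]" and r = "s / sqrt 2"])
      show "(dist (vector [x + s / 2, y + s / 2]) z)\<^sup>2 \<le> (s / sqrt 2)\<^sup>2"
      proof -
        have half: "(s / 2 - t * s)\<^sup>2 \<le> (s / 2)\<^sup>2" if "0 \<le> t" "t \<le> 1" for t
        proof -
          have "(s / 2 - t * s)\<^sup>2 = (s / 2)\<^sup>2 - t * (1 - t) * s\<^sup>2"
            by (simp add: field_simps power2_eq_square)
          then show ?thesis using that by simp
        qed
        show ?thesis unfolding r using half[of l] half[of \<mu>] lm by (simp add: dist_vec2 z)
      qed
      show "vertex_disk Q = cball (vector [x + s / 2, y + s / 2]) (s / sqrt 2)"
        unfolding Q by (rule vertex_disk_square) (rule s)
      show "(inv_stereo z - p) \<bullet> (inv_stereo y - p) = 0" if "y \<in> {q00, q10, q01}" for y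
        using that all by (auto simp: h_def)
    qed (use s r in \<open>auto simp: q\<close>)
    then have "norm (inv_stereo z - p) < hull_const Q" by (simp add: const)
    with p show ?thesis by blast
  next
    case left
    have hull: "p \<in> convex hull {inv_stereo q00, inv_stereo q01}"
      using face' hull_mono[OF image_mono[OF left, of inv_stereo]] by auto
    have "norm (inv_stereo z - p) \<le> (dist (inv_stereo q00) (inv_stereo q01))\<^sup>2 / 4"
      by (rule edge_approx[OF nth(1,2,3,4,5,6,7,8) z lm refl ss flip(5) bnd(1) hull]) (use hv in auto)
    then show ?thesis
      by (rule edge_v[where c = "-1"])
        (use s in \<open>auto simp: Qq q vec2_eq\<close>)
  next
    case right
    have hull: "p \<in> convex hull {inv_stereo q10, inv_stereo q11}"
      using face' hull_mono[OF image_mono[OF right, of inv_stereo]] by auto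
    have "norm (inv_stereo z - p) \<le> (dist (inv_stereo q10) (inv_stereo q11))\<^sup>2 / 4"
      by (rule edge_approx[OF nth(3,4) far(1) nth(2) nth(7,8) far(2) nth(6) far(5) z(2) flip(1,2) lm(3,4) flip(7) ss flip(6) bnd(2) hull]) (use hv in auto)
    then show ?thesis
      by (rule edge_v[where c = "1"])
        (use s in \<open>auto simp: Qq q vec2_eq\<close>)
  next
    case bottom
    have hull: "p \<in> convex hull {inv_stereo q00, inv_stereo q10}"
      using face' hull_mono[OF image_mono[OF bottom, of inv_stereo]] by auto
    have "norm (inv_stereo z - p) \<le> (dist (inv_stereo q00) (inv_stereo q10))\<^sup>2 / 4"
      by (rule edge_approx_swap[OF nth(2,1,6,5,4,3,8,7) z(2,1) lm(3,4,1,2) refl ss flip(5) bnd(3) hull]) (use hv in auto)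
    then show ?thesis
      by (rule edge_h[where c = "-1"])
        (use s in \<open>auto simp: Qq q vec2_eq\<close>)
  next
    case top
    have hull: "p \<in> convex hull {inv_stereo q01, inv_stereo q11}"
      using face' hull_mono[OF image_mono[OF top, of inv_stereo]] by auto
    have "norm (inv_stereo z - p) \<le> (dist (inv_stereo q01) (inv_stereo q11))\<^sup>2 / 4"
      by (rule edge_approx_swap[OF nth(6,5) far(3) nth(1) nth(8,7) far(4) nth(3) far(6) z(1) flip(3,4) lm(1,2) flip(7) ss flip(6) bnd(4) hull]) (use hv in auto)
    then show ?thesis
      by (rule edge_h[where c = "1"])
        (use s in \<open>auto simp: Qq q vec2_eq\<close>)
  qed
qed

section \<open>Hull approximation for segments\<close>

lemma dyadic_interval_nonneg: "dyadic_interval x s \<Longrightarrow> 0 \<le> x \<and> 0 < s"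
  by (induction rule: dyadic_interval.induct) auto

lemma dyadic_segmentE:
  assumes "dyadic_segment Q"
  obtains x s where "Q = segment_vertices x s" "0 \<le> x" "0 < s"
proof -
  from assms obtain x s where "dyadic_interval x s" "Q = segment_vertices x s"
    by (auto simp: dyadic_segment_def)
  then show ?thesis using that dyadic_interval_nonneg by blast
qed

text \<open>The image of the first coordinate axis is a great circle, and \<open>p\<close> is the foot of the
  perpendicular from the image of \<open>z\<close> to the chord. The foot lies on the chord because the segment starts
  at a nonnegative coordinate. Then \<open>w\<close> is perpendicular to the chord in the plane of
  the great circle, so it is parallel to the vector from the origin to the midpoint of the chord,
  and its norm is at most the height of the arc.\<close>
lemma segment_hull_approx:
  assumes "dyadic_segment Q" "z \<in> convex hull Q"
  shows "\<exists>p \<in> convex hull (inv_stereo ` Q). norm (inv_stereo z - p) < hull_const Q"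
proof -
  obtain a s where Q: "Q = segment_vertices a s" and s: "0 < s" "0 \<le> a"
    using dyadic_segmentE[OF assms(1)] by metis
  define b where "b = a + s"
  define qa qb :: "real^2" where q: "qa = vector [a, 0]" "qb = vector [b, 0]"
  have Qq: "Q = {qa, qb}" by (simp add: Q segment_vertices_def q b_def)
  have disk: "vertex_disk Q = cball (vector [a + s / 2, 0]) (s / 2)"
    unfolding Q by (rule vertex_disk_segment[OF s(1)])
  obtain \<mu> where \<mu>: "z = (1 - \<mu>) *\<^sub>R qa + \<mu> *\<^sub>R qb" "0 \<le> \<mu>" "\<mu> \<le> 1"
    using assms(2) by (auto simp: Qq segment_convex_hull[symmetric] in_segment)
  define t where "t = a + \<mu> * s"
  have z: "z$1 = t" "z$2 = 0" by (simp_all add: \<mu>(1) q t_def b_def algebra_simps)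
  have t: "a \<le> t" "t \<le> b" using \<mu> s by (simp_all add: t_def b_def mult_left_le_one_le)
  define e where "e = dist (inv_stereo qa) (inv_stereo qb)"
  define \<theta> where "\<theta> = (inv_stereo z - inv_stereo qa) \<bullet> (inv_stereo qb - inv_stereo qa) / e\<^sup>2"
  define p where "p = (1 - \<theta>) *\<^sub>R inv_stereo qa + \<theta> *\<^sub>R inv_stereo qb"
  define w where "w = inv_stereo z - p"
  define \<kappa> where "\<kappa> = w \<bullet> p"
  define k where "k = \<kappa> - w$3"
  have e2: "e\<^sup>2 = 4 * (b - a)\<^sup>2 / ((1 + a\<^sup>2) * (1 + b\<^sup>2))"
    by (simp add: e_def dist_inv_stereo) (simp add: dist_vec2 q denom_def power2_commute)
  have "qa \<noteq> qb" using s by (simp add: q vec2_eq b_def)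
  then have e: "0 < e" using inj_inv_stereo by (auto simp: e_def dest: injD)
  have d2: "(dist x y)\<^sup>2 = (x$1 - y$1)\<^sup>2 + (x$2 - y$2)\<^sup>2" for x y :: "real^2"
    by (simp add: dist_vec2)
  have ends: "0 \<le> (inv_stereo z - inv_stereo qa) \<bullet> (inv_stereo qb - inv_stereo qa)"
    "0 \<le> (inv_stereo z - inv_stereo qb) \<bullet> (inv_stereo qa - inv_stereo qb)"
  proof -
    have "denom qb * (dist z qa)\<^sup>2 + denom z * (dist qa qb)\<^sup>2 - denom qa * (dist z qb)\<^sup>2
        = 2 * (t - a) * (b - a) * (1 + b * t)"
      by (simp add: d2 q z denom_def) (simp add: algebra_simps power2_eq_square)
    also have "\<dots> \<ge> 0" using t s by simp
    finally show "0 \<le> (inv_stereo z - inv_stereo qa) \<bullet> (inv_stereo qb - inv_stereo qa)"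
      unfolding inner_chords using denom_pos by (simp add: less_imp_le)
    have "denom qa * (dist z qb)\<^sup>2 + denom z * (dist qb qa)\<^sup>2 - denom qb * (dist z qa)\<^sup>2
        = 2 * (b - t) * (b - a) * (1 + a * t)"
      by (simp add: d2 q z denom_def) (simp add: algebra_simps power2_eq_square)
    also have "\<dots> \<ge> 0" using t s by simp
    finally show "0 \<le> (inv_stereo z - inv_stereo qb) \<bullet> (inv_stereo qa - inv_stereo qb)"
      unfolding inner_chords using denom_pos by (simp add: less_imp_le)
  qed
  have ee: "(inv_stereo qb - inv_stereo qa) \<bullet> (inv_stereo qb - inv_stereo qa) = e\<^sup>2"
    unfolding e_def dist_commute[of "inv_stereo qa"] by (simp add: dist_norm power2_norm_eq_inner)
  have "(inv_stereo z - inv_stereo qb) \<bullet> (inv_stereo qa - inv_stereo qb)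
      = (inv_stereo qb - inv_stereo qa) \<bullet> (inv_stereo qb - inv_stereo qa)
        - (inv_stereo z - inv_stereo qa) \<bullet> (inv_stereo qb - inv_stereo qa)"
    by (simp add: inner_diff_left inner_diff_right inner_commute)
  then have \<theta>: "0 \<le> \<theta>" "\<theta> \<le> 1"
    using ends e unfolding \<theta>_def ee by (simp_all add: divide_le_eq)
  have p: "p \<in> convex hull (inv_stereo ` Q)"
    using \<theta> by (auto simp: Qq p_def segment_convex_hull[symmetric] in_segment)
  have pa: "p = inv_stereo qa + \<theta> *\<^sub>R (inv_stereo qb - inv_stereo qa)"
    by (simp add: p_def algebra_simps)
  have orth: "w \<bullet> (inv_stereo qb - inv_stereo qa) = 0"
  proof -
    have "w \<bullet> (inv_stereo qb - inv_stereo qa)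
       = (inv_stereo z - inv_stereo qa) \<bullet> (inv_stereo qb - inv_stereo qa)
         - \<theta> * ((inv_stereo qb - inv_stereo qa) \<bullet> (inv_stereo qb - inv_stereo qa))"
      unfolding w_def pa by (simp add: inner_diff_left inner_add_left)
    then show ?thesis using e by (simp add: ee \<theta>_def)
  qed
  have \<kappa>a: "w \<bullet> inv_stereo qa = \<kappa>" using orth by (simp add: \<kappa>_def pa inner_add_right)
  then have \<kappa>b: "w \<bullet> inv_stereo qb = \<kappa>" using orth by (simp add: inner_diff_right)
  have w2: "w$2 = 0"
    by (simp add: w_def p_def inv_stereo_nth q z)
  have \<Lambda>: "denom y * (w \<bullet> inv_stereo y - \<kappa>) = 2 * y$1 * w$1 - k * ((y$1)\<^sup>2 + (y$2)\<^sup>2) - (k + 2 * w$3)" for y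
    unfolding right_diff_distrib denom_inner_inv_stereo
    by (simp add: w2 denom_def k_def algebra_simps)
  have La: "2 * a * w$1 - k * a\<^sup>2 - (k + 2 * w$3) = 0" using \<Lambda>[of qa] unfolding \<kappa>a by (simp add: q)
  have Lb: "2 * b * w$1 - k * b\<^sup>2 - (k + 2 * w$3) = 0" using \<Lambda>[of qb] unfolding \<kappa>b by (simp add: q)
  have "(b - a) * (2 * w$1 - k * (a + b)) = 0"
    using La Lb by (simp add: algebra_simps power2_eq_square)
  then have w1: "w$1 = k * (a + b) / 2" using s by (simp add: b_def)
  have w3: "w$3 = k * (a * b - 1) / 2"
    using La unfolding w1 by (simp add: field_simps power2_eq_square)
  have \<kappa>: "\<kappa> = k * (1 + a * b) / 2"
    using w3 by (simp add: k_def field_simps)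
  have wz: "w \<bullet> inv_stereo z = \<kappa> + (norm w)\<^sup>2"
  proof -
    have "w \<bullet> (inv_stereo z - p) = (norm w)\<^sup>2" by (simp add: w_def power2_norm_eq_inner)
    then show ?thesis by (simp add: \<kappa>_def inner_diff_right)
  qed
  have zz: "denom z * (norm w)\<^sup>2 = k * ((t - a) * (b - t))"
    using \<Lambda>[of z] unfolding wz w1 w3 by (simp add: z field_simps power2_eq_square)
  define V where "V = sqrt ((1 + a\<^sup>2) * (1 + b\<^sup>2))"
  define \<rho> where "\<rho> = (1 + a * b) / V"
  have V: "0 < V" "V\<^sup>2 = (1 + a\<^sup>2) * (1 + b\<^sup>2)"
    by (simp_all add: V_def add_pos_nonneg zero_less_mult_iff)
  have W: "(norm w)\<^sup>2 = (k * V / 2)\<^sup>2"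
  proof -
    have "(norm w)\<^sup>2 = (k / 2)\<^sup>2 * ((1 + a\<^sup>2) * (1 + b\<^sup>2))"
      by (simp only: power2_norm_eq_inner inner_vec3 w1 w2 w3)
        (simp add: power2_eq_square field_simps)
    then show ?thesis unfolding V(2)[symmetric] by (simp add: power_mult_distrib power_divide)
  qed
  have \<rho>2: "4 * (1 - \<rho>\<^sup>2) = e\<^sup>2"
  proof -
    have "V\<^sup>2 * (1 - \<rho>\<^sup>2) = V\<^sup>2 - (1 + a * b)\<^sup>2"
      using V(1) by (simp add: \<rho>_def power_divide field_simps)
    also have "\<dots> = (b - a)\<^sup>2" unfolding V(2) by (simp add: algebra_simps power2_eq_square)
    finally show ?thesis unfolding e2 V(2)[symmetric] using V(1) by (simp add: field_simps)
  qed
  have "0 < 4 * (1 - \<rho>\<^sup>2)" unfolding \<rho>2 using e by simp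
  then have \<rho>: "0 \<le> \<rho>" "\<rho> < 1"
    using s V power_less_imp_less_base[of \<rho> 2 1] by (auto simp: \<rho>_def b_def)
  have "1 - \<rho> < chi 2 e" using \<rho> \<rho>2 by (intro chi_sagitta) auto
  also have "\<dots> \<le> chi 2 (disk_diam Q)"
    unfolding e_def using s
    by (intro chi_mono dist_le_disk_diam[OF disk]) (auto simp: q b_def dist_vec2)
  finally have sag: "1 - \<rho> < hull_const Q" using assms(1) by (simp add: hull_const_def)
  have "norm w < hull_const Q"
  proof (cases "w = 0")
    case False
    have "0 < k * ((t - a) * (b - t))"
      unfolding zz[symmetric] using False denom_pos by simp
    moreover have "0 \<le> (t - a) * (b - t)" using t by simp
    ultimately have "0 < k" by (simp add: zero_less_mult_iff)
    then have nw: "norm w = k * V / 2" using W V by (simp add: power2_eq_iff_nonneg)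
    have "\<kappa> = \<rho> * norm w" using V by (simp add: nw \<kappa> \<rho>_def)
    then have "norm w \<le> 1 - \<rho>" using False wz by (intro cap_depth[of w "inv_stereo z"]) auto
    with sag show ?thesis by simp
  qed (use sag \<rho> in simp)
  then show ?thesis using p by (auto simp: w_def)
qed

section \<open>Error of a pair of cells\<close>

definition block_cell :: "(real^2) set \<Rightarrow> bool" where
  "block_cell Q \<longleftrightarrow> dyadic_segment Q \<or> good_square Q"

lemma hull_approx:
  assumes "block_cell Q" "z \<in> convex hull Q"
  shows "\<exists>p \<in> convex hull (inv_stereo ` Q). norm (inv_stereo z - p) < hull_const Q"
  using assms segment_hull_approx square_hull_approx by (auto simp: block_cell_def)

lemma block_cell_vertices:
  assumes "block_cell Q"
  shows "finite Q" "\<exists>q\<in>Q. q \<noteq> 0"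
proof -
  have seg: "finite Q \<and> (\<exists>q\<in>Q. q \<noteq> 0)" if Q: "dyadic_segment Q"
  proof -
    obtain x s where "Q = segment_vertices x s" "0 \<le> x" "0 < s"
      using dyadic_segmentE[OF Q] by blast
    moreover from this have "vector [x + s, 0] \<in> Q" "vector [x + s, 0] \<noteq> (0 :: real^2)"
      by (auto simp: segment_vertices_def vec_eq_iff forall_2)
    ultimately show ?thesis by (auto simp: segment_vertices_def)
  qed
  have sq: "finite Q \<and> (\<exists>q\<in>Q. q \<noteq> 0)" if Q: "good_square Q"
  proof -
    obtain x y s where "Q = square_vertices x y s" "0 < s"
      using good_squareE[OF Q] by blast
    moreover from this have "vector [x, y] \<in> Q" "vector [x + s, y] \<in> Q"
        "vector [x, y] \<noteq> (0 :: real^2) \<or> vector [x + s, y] \<noteq> (0 :: real^2)"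
      by (auto simp: square_vertices_def vec_eq_iff forall_2)
    ultimately show ?thesis by (auto simp: square_vertices_def)
  qed
  from seg sq assms show "finite Q" "\<exists>q\<in>Q. q \<noteq> 0" by (auto simp: block_cell_def)
qed

lemma hull_const_pos:
  assumes "block_cell Q"
  shows "0 < hull_const Q"
proof -
  obtain q where "q \<in> Q" using block_cell_vertices[OF assms] by blast
  then obtain p where "norm (inv_stereo q - p) < hull_const Q"
    using hull_approx[OF assms, of q] hull_inc[of q Q] by blast
  then show ?thesis using norm_ge_zero order_le_less_trans by blast
qed

fun cell_points :: "cell \<Rightarrow> (real^2) option set" where
  "cell_points (Cell Q) = Some ` (convex hull Q)"
| "cell_points Infinity = {None}"

fun valid_cell :: "cell \<Rightarrow> bool" where
  "valid_cell (Cell Q) = block_cell Q"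
| "valid_cell Infinity = True"

lemma norm_hat [simp]: "norm (hat x) = 1"
proof (cases x)
  case None
  then show ?thesis by (simp add: norm_eq_1 inner_vec3 vector_3)
qed simp

lemma abs_inner_hat: "\<bar>v \<bullet> hat x\<bar> \<le> norm v"
  using Cauchy_Schwarz_ineq2[of v "hat x"] by simp

lemma inner_unit_ge: "norm v = 1 \<Longrightarrow> 0 \<le> 2 + 2 * (v \<bullet> hat x)"
  using abs_inner_hat[of v x] by simp

lemma inner_hat_None: "inv_stereo q \<bullet> hat None = 1 - 2 / denom q"
  by (simp add: inner_vec3 vector_3 inv_stereo_nth)

text \<open>For two finite cells, expand both points around nearby points of the vertex hulls. The inner
  product is linear in each of these, so it is largest at vertices, and the three remaining terms
  are bounded by the hull constants. For the point at infinity, the height of the image grows with the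
  norm in the plane, and the norm is largest at a vertex.\<close>
lemma dot_max_upper:
  assumes "block_cell Q" "valid_cell C" "z \<in> convex hull Q" "x \<in> cell_points C"
  shows "inv_stereo z \<bullet> hat x \<le> dot_max Q C"
proof (cases C)
  case (Cell Q')
  then obtain z' where z': "x = Some z'" "z' \<in> convex hull Q'" and Q': "block_cell Q'"
    using assms by auto
  define S where "S = {inv_stereo q \<bullet> inv_stereo q' | q q'. q \<in> Q \<and> q' \<in> Q'}"
  have fin: "finite S" unfolding S_def
    using block_cell_vertices assms(1) Q' by (intro finite_image_set2) auto
  obtain p where p: "p \<in> convex hull (inv_stereo ` Q)" "norm (inv_stereo z - p) < hull_const Q"
    using hull_approx[OF assms(1,3)] by blast
  obtain p' where p': "p' \<in> convex hull (inv_stereo ` Q')" "norm (inv_stereo z' - p') < hull_const Q'"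
    using hull_approx[OF Q' z'(2)] by blast
  have "inv_stereo q \<bullet> p' \<le> Max S" if "q \<in> Q" for q
  proof -
    have "convex hull (inv_stereo ` Q') \<subseteq> {X. inv_stereo q \<bullet> X \<le> Max S}"
      using fin that by (intro hull_minimal convex_halfspace_le) (auto simp: S_def intro!: Max_ge)
    then show ?thesis using p' by blast
  qed
  then have "convex hull (inv_stereo ` Q) \<subseteq> {X. p' \<bullet> X \<le> Max S}"
    by (intro hull_minimal convex_halfspace_le) (auto simp: inner_commute)
  then have pp: "p \<bullet> p' \<le> Max S" using p by (auto simp: inner_commute)
  have "convex hull (inv_stereo ` Q) \<subseteq> cball 0 1" "convex hull (inv_stereo ` Q') \<subseteq> cball 0 1"
    by (intro hull_minimal convex_cball; auto)+
  then have n: "norm p \<le> 1" "norm p' \<le> 1" using p p' by auto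
  define e where "e = inv_stereo z - p"
  define e' where "e' = inv_stereo z' - p'"
  have "inv_stereo z \<bullet> inv_stereo z' = p \<bullet> p' + e \<bullet> p' + p \<bullet> e' + e \<bullet> e'"
    by (simp add: e_def e'_def inner_diff_left inner_diff_right)
  moreover have "e \<bullet> p' \<le> hull_const Q"
    using norm_cauchy_schwarz[of e p'] mult_left_mono[OF n(2), of "norm e"] p(2) by (simp add: e_def)
  moreover have "p \<bullet> e' \<le> hull_const Q'"
    using norm_cauchy_schwarz[of p e'] mult_right_mono[OF n(1), of "norm e'"] p'(2) by (simp add: e'_def)
  moreover have "e \<bullet> e' \<le> hull_const Q * hull_const Q'"
    using norm_cauchy_schwarz[of e e'] mult_mono[of "norm e" "hull_const Q" "norm e'" "hull_const Q'"]
      p p' hull_const_pos[OF assms(1)] by (simp add: e_def e'_def)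
  ultimately show ?thesis using pp by (simp add: Cell z' S_def)
next
  case Infinity
  then have x: "x = None" using assms by simp
  have fin: "finite Q" "Q \<noteq> {}" using block_cell_vertices[OF assms(1)] by auto
  have "Max (norm ` Q) \<in> norm ` Q" using fin by simp
  then obtain q where q: "q \<in> Q" "norm q = Max (norm ` Q)" by (metis imageE)
  have "convex hull Q \<subseteq> cball 0 (norm q)"
    using fin by (intro hull_minimal convex_cball) (auto simp: q(2))
  then have "norm z \<le> norm q" using assms by auto
  then have "denom z \<le> denom q" by (simp add: denom_alt)
  then have "2 / denom q \<le> 2 / denom z" using denom_pos by (intro divide_left_mono) auto
  then have "inv_stereo z \<bullet> hat None \<le> inv_stereo q \<bullet> hat None"
    unfolding inner_hat_None by simp
  also have "\<dots> \<le> dot_max Q Infinity"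
    using q fin unfolding dot_max.simps by (intro Max_ge finite_image_set) auto
  finally show ?thesis using x Infinity by simp
qed

text \<open>Strict positivity makes the error of a pair strictly larger than the deviation. Against a
  finite cell it comes from the hull constants, against infinity from a vertex other than the
  origin.\<close>
lemma dot_max_lower:
  assumes "block_cell Q" "valid_cell C"
  shows "0 < 2 + 2 * dot_max Q C"
proof -
  obtain q where q: "q \<in> Q" "q \<noteq> 0" using block_cell_vertices[OF assms(1)] by blast
  show ?thesis
  proof (cases C)
    case (Cell Q')
    then have Q': "block_cell Q'" using assms by simp
    obtain q' where q': "q' \<in> Q'" using block_cell_vertices[OF Q'] by blast
    have "finite {inv_stereo q \<bullet> inv_stereo q' | q q'. q \<in> Q \<and> q' \<in> Q'}"
      using block_cell_vertices assms(1) Q' by (intro finite_image_set2) auto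
    then have "inv_stereo q \<bullet> inv_stereo q' \<le> Max {inv_stereo q \<bullet> inv_stereo q' | q q'. q \<in> Q \<and> q' \<in> Q'}"
      using q q' by (intro Max_ge) auto
    moreover have "0 \<le> 2 + 2 * (inv_stereo q \<bullet> inv_stereo q')"
      using inner_unit_ge[of "inv_stereo q" "Some q'"] by simp
    moreover note hull_const_pos[OF assms(1)] hull_const_pos[OF Q']
      mult_pos_pos[OF hull_const_pos[OF assms(1)] hull_const_pos[OF Q']]
    moreover have "0 < 2 + 2 * (M + d + d' + e)"
      if "i \<le> M" "0 \<le> 2 + 2 * i" "0 < d" "0 < d'" "0 < e" for i M d d' e :: real
      using that by simp
    ultimately show ?thesis unfolding Cell dot_max.simps by blast
  next
    case Infinity
    have "1 < denom q" using q(2) by (simp add: denom_alt)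
    then have "0 < 2 + 2 * (inv_stereo q \<bullet> hat None)"
      unfolding inner_hat_None by (simp add: field_simps)
    moreover have "inv_stereo q \<bullet> hat None \<le> dot_max Q C"
      using assms q by (intro dot_max_upper) (auto simp: Infinity hull_inc)
    ultimately show ?thesis by linarith
  qed
qed

lemma convex_hull_image_weights:
  assumes "finite Q" "inj_on f Q" "p \<in> convex hull (f ` Q)"
  obtains u where "\<And>q. q \<in> Q \<Longrightarrow> 0 \<le> u q" "sum u Q = 1" "p = (\<Sum>q\<in>Q. u q *\<^sub>R f q)"
proof -
  obtain v where "\<forall>x \<in> f ` Q. 0 \<le> v x" "sum v (f ` Q) = 1" "(\<Sum>x \<in> f ` Q. v x *\<^sub>R x) = p"
    using assms(1,3) by (auto simp: convex_hull_finite)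
  then show ?thesis
    using that[of "v \<circ> f"] assms(2) by (simp add: sum.reindex)
qed

lemma pair_average:
  assumes Q: "block_cell Q" and C: "valid_cell C" and z: "z \<in> convex hull Q" and x: "x \<in> cell_points C"
    and u: "\<And>q. q \<in> Q \<Longrightarrow> 0 \<le> u q" "sum u Q = 1"
    and near: "norm (inv_stereo z - (\<Sum>q\<in>Q. u q *\<^sub>R inv_stereo q)) < hull_const Q"
    and "1 \<le> k"
  shows "\<bar>(\<Sum>q\<in>Q. u q * (2 + 2 * (inv_stereo q \<bullet> hat x)) ^ k) - (2 + 2 * (inv_stereo z \<bullet> hat x)) ^ k\<bar>
    < pair_error k Q C"
  unfolding pair_error_def Let_def
proof (rule average_power_diff[OF _ u _ _ _ _ _ dot_max_lower[OF Q C] \<open>1 \<le> k\<close>])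
  show "finite Q" by (rule block_cell_vertices[OF Q])
  show "0 \<le> 2 + 2 * (inv_stereo z \<bullet> hat x)" by (simp add: inner_unit_ge)
  show "2 + 2 * (inv_stereo z \<bullet> hat x) \<le> 2 + 2 * dot_max Q C"
    using dot_max_upper[OF Q C z x] by simp
  show "0 \<le> 2 + 2 * (inv_stereo q \<bullet> hat x) \<and> 2 + 2 * (inv_stereo q \<bullet> hat x) \<le> 2 + 2 * dot_max Q C"
    if "q \<in> Q" for q
    using dot_max_upper[OF Q C _ x, of q] that by (simp add: inner_unit_ge hull_inc)
  show "2 + 2 * (inv_stereo q \<bullet> hat x) - (2 + 2 * (inv_stereo q' \<bullet> hat x)) \<le> 2 * hull_diam Q"
    if "q \<in> Q" "q' \<in> Q" for q q'
  proof -
    have "inv_stereo q \<bullet> hat x - inv_stereo q' \<bullet> hat x \<le> dist (inv_stereo q) (inv_stereo q')"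
      using abs_inner_hat[of "inv_stereo q - inv_stereo q'" x] by (simp add: inner_diff_left dist_norm)
    also have "\<dots> \<le> hull_diam Q"
      unfolding hull_diam_def using that
      by (intro diameter_bounded_bound bounded_convex_hull bounded_inv_stereo hull_inc imageI)
    finally show ?thesis by simp
  qed
  have "2 + 2 * (inv_stereo z \<bullet> hat x) - (\<Sum>q\<in>Q. u q * (2 + 2 * (inv_stereo q \<bullet> hat x)))
      = 2 * ((inv_stereo z - (\<Sum>q\<in>Q. u q *\<^sub>R inv_stereo q)) \<bullet> hat x)"
  proof -
    have "(\<Sum>q\<in>Q. u q * (2 + 2 * (inv_stereo q \<bullet> hat x)))
        = 2 * sum u Q + 2 * (\<Sum>q\<in>Q. u q * (inv_stereo q \<bullet> hat x))"
      by (simp add: sum.distrib sum_distrib_left sum_distrib_right algebra_simps)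
    then show ?thesis by (simp add: u inner_diff_left inner_sum_left)
  qed
  then show "\<bar>2 + 2 * (inv_stereo z \<bullet> hat x) - (\<Sum>q\<in>Q. u q * (2 + 2 * (inv_stereo q \<bullet> hat x)))\<bar>
      < 2 * hull_const Q"
    using abs_inner_hat[of "inv_stereo z - (\<Sum>q\<in>Q. u q *\<^sub>R inv_stereo q)" x] near
    by (simp add: abs_mult)
qed

section \<open>Replacing points by vertices\<close>

definition dot_potential :: "(nat \<Rightarrow> real) \<Rightarrow> nat \<Rightarrow> real \<Rightarrow> real" where
  "dot_potential a N x = (\<Sum>k = 1..N. a k * (2 + 2 * x) ^ k)"

lemma potential_unit:
  assumes "norm p = 1" "norm q = 1"
  shows "potential a N (norm (p - q)) = dot_potential a N (p \<bullet> q)"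
proof -
  have "4 - (norm (p - q))\<^sup>2 = 2 + 2 * (p \<bullet> q)"
    using dot_norm_neg[of p q] assms by simp
  then show ?thesis by (simp only: potential_def dot_potential_def G_def)
qed

definition cell_error :: "(nat \<Rightarrow> real) \<Rightarrow> nat \<Rightarrow> (real^2) set \<Rightarrow> cell \<Rightarrow> real" where
  "cell_error a N Q C = (\<Sum>k = 1..N. \<bar>a k\<bar> * pair_error k Q C)"

text \<open>The weighted average of the vertex energies stays below the right-hand side, so not all of them
  can reach it. Deviations of the \<open>k\<close>-th powers are bounded in absolute value, so coefficients of
  either sign contribute at most \<open>\<bar>a k\<bar>\<close> times the error; strictness needs one nonzero coefficient.\<close>
lemma vertex_step:
  fixes C :: "'j \<Rightarrow> cell"
  assumes Q: "block_cell Q" and z: "z \<in> convex hull Q" and J: "finite J" "J \<noteq> {}"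
    and C: "\<And>j. j \<in> J \<Longrightarrow> valid_cell (C j)" "\<And>j. j \<in> J \<Longrightarrow> x j \<in> cell_points (C j)"
    and a: "\<exists>k \<in> {1..N}. a k \<noteq> 0"
  shows "\<exists>q\<in>Q. (\<Sum>j\<in>J. dot_potential a N (inv_stereo q \<bullet> hat (x j)))
    < (\<Sum>j\<in>J. dot_potential a N (inv_stereo z \<bullet> hat (x j))) + (\<Sum>j\<in>J. cell_error a N Q (C j))"
proof -
  obtain p where p: "p \<in> convex hull (inv_stereo ` Q)" "norm (inv_stereo z - p) < hull_const Q"
    using hull_approx[OF Q z] by blast
  obtain u where u: "\<And>q. q \<in> Q \<Longrightarrow> 0 \<le> u q" "sum u Q = 1" "p = (\<Sum>q\<in>Q. u q *\<^sub>R inv_stereo q)"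
    using convex_hull_image_weights[OF block_cell_vertices(1)[OF Q] inj_on_subset[OF inj_inv_stereo subset_UNIV] p(1)]
    by blast
  define M where "M = (\<Sum>j\<in>J. dot_potential a N (inv_stereo z \<bullet> hat (x j))) + (\<Sum>j\<in>J. cell_error a N Q (C j))"
  have each: "(\<Sum>q\<in>Q. u q * dot_potential a N (inv_stereo q \<bullet> hat (x j)))
      < dot_potential a N (inv_stereo z \<bullet> hat (x j)) + cell_error a N Q (C j)" if "j \<in> J" for j
  proof -
    define A where "A k = (\<Sum>q\<in>Q. u q * (2 + 2 * (inv_stereo q \<bullet> hat (x j))) ^ k)" for k
    define B where "B k = (2 + 2 * (inv_stereo z \<bullet> hat (x j))) ^ k" for k
    have AB: "\<bar>A k - B k\<bar> < pair_error k Q (C j)" if "1 \<le> k" for k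
      unfolding A_def B_def using that u p \<open>j \<in> J\<close> C by (intro pair_average Q z) auto
    have le: "a k * A k \<le> a k * B k + \<bar>a k\<bar> * pair_error k Q (C j) \<and>
        (a k \<noteq> 0 \<longrightarrow> a k * A k < a k * B k + \<bar>a k\<bar> * pair_error k Q (C j))" if "1 \<le> k" for k
    proof (cases "a k = 0")
      case False
      have "a k * (A k - B k) \<le> \<bar>a k\<bar> * \<bar>A k - B k\<bar>" by (metis abs_ge_self abs_mult)
      also have "\<dots> < \<bar>a k\<bar> * pair_error k Q (C j)"
        using False AB[OF that] by (intro mult_strict_left_mono) auto
      finally show ?thesis by (simp add: algebra_simps)
    qed simp
    have "(\<Sum>k = 1..N. a k * A k) < (\<Sum>k = 1..N. a k * B k + \<bar>a k\<bar> * pair_error k Q (C j))"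
    proof (rule sum_strict_mono_ex1)
      show "\<exists>k\<in>{1..N}. a k * A k < a k * B k + \<bar>a k\<bar> * pair_error k Q (C j)"
        using le a by (meson atLeastAtMost_iff)
    qed (use le in auto)
    moreover have "(\<Sum>q\<in>Q. u q * dot_potential a N (inv_stereo q \<bullet> hat (x j))) = (\<Sum>k = 1..N. a k * A k)"
      unfolding dot_potential_def A_def sum_distrib_left
      by (subst sum.swap) (simp add: mult.left_commute)
    ultimately show ?thesis
      by (simp add: dot_potential_def cell_error_def B_def sum.distrib)
  qed
  show ?thesis
  proof (rule ccontr)
    assume "\<not> ?thesis"
    then have "M \<le> (\<Sum>j\<in>J. dot_potential a N (inv_stereo q \<bullet> hat (x j)))" if "q \<in> Q" for q
      using that by (auto simp: M_def not_less)
    then have "(\<Sum>q\<in>Q. u q * M) \<le> (\<Sum>q\<in>Q. u q * (\<Sum>j\<in>J. dot_potential a N (inv_stereo q \<bullet> hat (x j))))"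
      using u by (intro sum_mono mult_left_mono) auto
    also have "\<dots> = (\<Sum>j\<in>J. \<Sum>q\<in>Q. u q * dot_potential a N (inv_stereo q \<bullet> hat (x j)))"
      unfolding sum_distrib_left by (rule sum.swap)
    also have "\<dots> < (\<Sum>j\<in>J. dot_potential a N (inv_stereo z \<bullet> hat (x j)) + cell_error a N Q (C j))"
      using J each by (intro sum_strict_mono) auto
    also have "\<dots> = M" by (simp add: M_def sum.distrib)
    also have "(\<Sum>q\<in>Q. u q * M) = M" using u(2) by (simp flip: sum_distrib_right)
    finally show False by simp
  qed
qed

text \<open>The energy as a function of an indexed family of points of the extended plane, so that one
  point can be replaced by a function update.\<close>
definition point_energy :: "(nat \<Rightarrow> real) \<Rightarrow> nat \<Rightarrow> (nat \<Rightarrow> (real^2) option) \<Rightarrow> real" where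
  "point_energy a N x = (\<Sum>j = 0..4. \<Sum>i<j. dot_potential a N (hat (x i) \<bullet> hat (x j)))"

lemma energy_eq_point_energy:
  "energy (potential a N) (z0, z1, z2, z3)
    = point_energy a N ((!) [Some z0, Some z1, Some z2, Some z3, None])"
  by (simp add: energy_def point_energy_def Let_def potential_unit del: hat.simps)

lemma sum_0_4: "sum f {0..4::nat} = f 0 + f 1 + f 2 + f 3 + (f 4 :: real)"
  by (simp add: numeral_eq_Suc add.assoc)

lemma point_energy_update:
  assumes "i \<le> 4"
  shows "point_energy a N (x(i := y)) - (\<Sum>j \<in> {0..4} - {i}. dot_potential a N (hat y \<bullet> hat (x j)))
    = point_energy a N x - (\<Sum>j \<in> {0..4} - {i}. dot_potential a N (hat (x i) \<bullet> hat (x j)))"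
proof -
  define f where "f p q = dot_potential a N (hat p \<bullet> hat q)" for p q
  have sym: "f p q = f q p" for p q by (simp add: f_def inner_commute)
  have lt: "{..<0} = ({}::nat set)" "{..<1} = {0::nat}" "{..<2} = {0, 1::nat}"
    "{..<3} = {0, 1, 2::nat}" "{..<4} = {0, 1, 2, 3::nat}" by auto
  have E: "point_energy a N x = f (x 0) (x 1) + (f (x 0) (x 2) + f (x 1) (x 2))
      + (f (x 0) (x 3) + f (x 1) (x 3) + f (x 2) (x 3))
      + (f (x 0) (x 4) + f (x 1) (x 4) + f (x 2) (x 4) + f (x 3) (x 4))" for x
    unfolding point_energy_def f_def[symmetric] sum_0_4 lt by simp
  have rm: "(\<Sum>j \<in> {0..4} - {i}. g j) = g 0 + g 1 + g 2 + g 3 + g 4 - g i" for g :: "nat \<Rightarrow> real"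
    using assms by (simp add: sum_diff1 sum_0_4)
  consider "i = 0" | "i = 1" | "i = 2" | "i = 3" | "i = 4" using assms by linarith
  then show ?thesis
    unfolding E f_def[symmetric] rm
    by cases (simp_all add: sym[of "x 1" "x 0"] sym[of "x 2" "x 0"] sym[of "x 2" "x 1"]
      sym[of "x 3" "x 0"] sym[of "x 3" "x 1"] sym[of "x 3" "x 2"]
      sym[of "x 4" "x 0"] sym[of "x 4" "x 1"] sym[of "x 4" "x 2"] sym[of "x 4" "x 3"]
      sym[of "x 0" y] sym[of "x 1" y] sym[of "x 2" y] sym[of "x 3" y] sym[of "x 4" y] del: One_nat_def)
qed

lemma ERR_eq_cell_errors:
  "ERR a N B = (\<Sum>i<4. \<Sum>j \<in> {0..4} - {i}. cell_error a N (block_member B i) (cell_of B j))"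
proof -
  have "(\<Sum>j = 0..4. \<Sum>k = 1..N. \<bar>a k\<bar> * block_error k B i j)
      = (\<Sum>j \<in> {0..4} - {i}. cell_error a N (block_member B i) (cell_of B j))" if "i < 4" for i
  proof -
    have "(\<Sum>j = 0..4. \<Sum>k = 1..N. \<bar>a k\<bar> * block_error k B i j)
        = (\<Sum>j \<in> {0..4} - {i}. \<Sum>k = 1..N. \<bar>a k\<bar> * block_error k B i j)"
      using that by (subst sum.remove[of _ i]) (simp_all add: block_error_def)
    also have "\<dots> = (\<Sum>j \<in> {0..4} - {i}. cell_error a N (block_member B i) (cell_of B j))"
      by (intro sum.cong) (auto simp: cell_error_def block_error_def)
    finally show ?thesis .
  qed
  moreover have "{0..3} = {..<4::nat}" by auto
  ultimately show ?thesis unfolding ERR_def by (auto intro!: sum.cong)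
qed

text \<open>The first \<open>n\<close> points are already vertices. Each further point moves while the others stay in
  their solid cells, so the bound of one step applies irrespective of the order. The estimate is strict as
  soon as one point has moved.\<close>
lemma vertices_by_steps:
  assumes B: "\<And>i. i < 4 \<Longrightarrow> block_cell (block_member B i)" and a: "\<exists>k \<in> {1..N}. a k \<noteq> 0"
    and x: "\<And>j. j \<le> 4 \<Longrightarrow> x j \<in> cell_points (cell_of B j)" and "n \<le> 4"
  shows "\<exists>y. (\<forall>j\<le>4. y j \<in> cell_points (cell_of B j)) \<and> (\<forall>j<n. y j \<in> Some ` block_member B j) \<and>
    point_energy a N y \<le> point_energy a N x
      + (\<Sum>i<n. \<Sum>j \<in> {0..4} - {i}. cell_error a N (block_member B i) (cell_of B j)) \<and>
    (0 < n \<longrightarrow> point_energy a N y < point_energy a N x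
      + (\<Sum>i<n. \<Sum>j \<in> {0..4} - {i}. cell_error a N (block_member B i) (cell_of B j)))"
  using \<open>n \<le> 4\<close>
proof (induction n)
  case 0
  then show ?case using x by (intro exI[of _ x]) auto
next
  case (Suc n)
  then obtain y where y: "\<And>j. j \<le> 4 \<Longrightarrow> y j \<in> cell_points (cell_of B j)"
      "\<And>j. j < n \<Longrightarrow> y j \<in> Some ` block_member B j"
      "point_energy a N y \<le> point_energy a N x
      + (\<Sum>i<n. \<Sum>j \<in> {0..4} - {i}. cell_error a N (block_member B i) (cell_of B j))"
    by auto
  have n: "n < 4" using Suc by simp
  obtain z where z: "y n = Some z" "z \<in> convex hull block_member B n"
    using y(1)[of n] n by (auto simp: cell_of_def)
  have valid: "valid_cell (cell_of B j)" for j using B by (simp add: cell_of_def)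
  have "{0..4} - {n} \<noteq> {}" using n by (cases "n = 0") (auto simp: set_eq_iff)
  then obtain q where q: "q \<in> block_member B n"
      "(\<Sum>j \<in> {0..4} - {n}. dot_potential a N (inv_stereo q \<bullet> hat (y j)))
        < (\<Sum>j \<in> {0..4} - {n}. dot_potential a N (inv_stereo z \<bullet> hat (y j)))
          + (\<Sum>j \<in> {0..4} - {n}. cell_error a N (block_member B n) (cell_of B j))"
    using vertex_step[OF B[OF n] z(2), of "{0..4} - {n}" "cell_of B" y N a] valid y(1) a by auto
  define y' where "y' = y(n := Some q)"
  have "point_energy a N y' < point_energy a N y
      + (\<Sum>j \<in> {0..4} - {n}. cell_error a N (block_member B n) (cell_of B j))"
    using point_energy_update[of n a N y "Some q"] n q(2) z(1) by (simp add: y'_def)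
  then have less: "point_energy a N y' < point_energy a N x
      + (\<Sum>i<Suc n. \<Sum>j \<in> {0..4} - {i}. cell_error a N (block_member B i) (cell_of B j))"
    using y(3) by simp
  have "\<forall>j\<le>4. y' j \<in> cell_points (cell_of B j)"
    using y(1) n q(1) by (auto simp: y'_def cell_of_def hull_inc)
  moreover have "\<forall>j<Suc n. y' j \<in> Some ` block_member B j"
    using y(2) q(1) by (auto simp: y'_def less_Suc_eq)
  ultimately show ?case using less less_imp_le[OF less] by blast
qed

theorem theorem9p2p1:
  fixes a :: "nat \<Rightarrow> real" and N :: nat and B :: block
  assumes "good_block B" and "\<exists>k \<in> {1..N}. a k \<noteq> 0"
  shows "(INF v \<in> block_solid B. energy (potential a N) v)
    > Min (energy (potential a N) ` block_vertices B) - ERR a N B"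
proof -
  obtain Q0 Q1 Q2 Q3 where B: "B = (Q0, Q1, Q2, Q3)" by (cases B)
  obtain z0 z1 z2 z3 where solid: "(z0, z1, z2, z3) \<in> block_solid B"
      and inf: "(INF u \<in> block_solid B. energy (potential a N) u) = energy (potential a N) (z0, z1, z2, z3)"
    using energy_attains_min[OF assms(1), of a N] by auto
  have lt4: "i = 0 \<or> i = 1 \<or> i = 2 \<or> i = 3" if "i < 4" for i :: nat using that by auto
  have cells: "block_cell (block_member B i)" if "i < 4" for i
    using lt4[OF that] assms(1) by (auto simp: B block_cell_def)
  define x where "x = (!) [Some z0, Some z1, Some z2, Some z3, None]"
  have x: "x j \<in> cell_points (cell_of B j)" if "j \<le> 4" for j
  proof (cases "j < 4")
    case True
    then show ?thesis using lt4[OF True] solid by (auto simp: x_def B cell_of_def)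
  next
    case False
    then have "j = 4" using that by simp
    then show ?thesis by (simp add: x_def cell_of_def)
  qed
  obtain y where y: "\<forall>j\<le>4. y j \<in> cell_points (cell_of B j)" "\<forall>j<4. y j \<in> Some ` block_member B j"
      "point_energy a N y < point_energy a N x + ERR a N B"
    using vertices_by_steps[of B N a x 4, OF cells assms(2) x] by (auto simp: ERR_eq_cell_errors)
  obtain q0 where q0: "y 0 = Some q0" "q0 \<in> Q0" using y(2)[rule_format, of 0] by (auto simp: B)
  obtain q1 where q1: "y 1 = Some q1" "q1 \<in> Q1" using y(2)[rule_format, of 1] by (auto simp: B)
  obtain q2 where q2: "y 2 = Some q2" "q2 \<in> Q2" using y(2)[rule_format, of 2] by (auto simp: B)
  obtain q3 where q3: "y 3 = Some q3" "q3 \<in> Q3" using y(2)[rule_format, of 3] by (auto simp: B)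
  have y4: "y 4 = None" using y(1)[rule_format, of 4] by (simp add: cell_of_def)
  have "point_energy a N y = energy (potential a N) (q0, q1, q2, q3)"
  proof -
    have *: "y j = [Some q0, Some q1, Some q2, Some q3, None] ! j" if "j \<le> 4" for j
    proof -
      have "j = 0 \<or> j = 1 \<or> j = 2 \<or> j = 3 \<or> j = 4" using that by auto
      then show ?thesis using q0 q1 q2 q3 y4 by auto
    qed
    show ?thesis
      unfolding energy_eq_point_energy point_energy_def
    proof (intro sum.cong refl)
      fix i j :: nat
      assume "j \<in> {0..4}" "i \<in> {..<j}"
      then have "i \<le> 4" "j \<le> 4" by auto
      then show "dot_potential a N (hat (y i) \<bullet> hat (y j))
          = dot_potential a N (hat ([Some q0, Some q1, Some q2, Some q3, None] ! i)
              \<bullet> hat ([Some q0, Some q1, Some q2, Some q3, None] ! j))"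
        by (simp only: *)
    qed
  qed
  moreover have "Min (energy (potential a N) ` block_vertices B) \<le> energy (potential a N) (q0, q1, q2, q3)"
  proof (rule Min_le)
    have "finite Q0" "finite Q1" "finite Q2" "finite Q3"
      using block_cell_vertices(1)[OF cells[of 0]] block_cell_vertices(1)[OF cells[of 1]]
        block_cell_vertices(1)[OF cells[of 2]] block_cell_vertices(1)[OF cells[of 3]] by (simp_all add: B)
    then show "finite (energy (potential a N) ` block_vertices B)" by (simp add: B)
  qed (use q0 q1 q2 q3 in \<open>simp add: B\<close>)
  moreover have "point_energy a N x = energy (potential a N) (z0, z1, z2, z3)"
    by (simp add: x_def energy_eq_point_energy)
  ultimately show ?thesis using y(3) inf by linarith
qed


end
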